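(* Let $n\ge1$ denote a fixed degree and let $r_\omega\in\mathcal{U}_n$ denote the best approximation to $\mathrm{e}^{\mathrm{i} \omega x}$ for $\omega\in(0,(n+1)\pi)$. Then the poles $s_1(\omega),\ldots,s_n(\omega)\in\mathbb{C}$ of $r_\omega$ can be numbered such that $$s_j(\omega) \to \mathrm{i} \left(-1 +\frac{2j}{n+1}\right)\quad\text{for } j=1,\ldots,n \text{ and } \omega\to (n+1)\pi^-.$$ In particular, $\operatorname{Re} s_j(\omega) \to 0^+$ in this limit.
   Context: For a complex polynomial $p$ let $p^\dag(z):=\overline{p}(-z)=\overline{p(-\overline z)}$, where $\overline p$ has complex-conjugated coefficients. Let $\mathcal{U}_n:=\{p^\dag/p : p \text{ a complex polynomial of degree}\le n,\ p\not\equiv 0\}$, with rational functions identified with their irreducible form; then $|r(\mathrm{i}x)|=1$ for $r\in\mathcal{U}_n$, $x\in\mathbb{R}$. For $r\in\mathcal{U}_n$, $\|r-\exp(\omega\cdot)\|:=\max_{x\in[-1,1]}|r(\mathrm{i}x)-\mathrm{e}^{\mathrm{i}\omega x}|$. For $\omega\in(0,(n+1)\pi)$ the best approximation $r_\omega$ is the (existing and unique) element of $\mathcal{U}_n$ with $\|r_\omega-\exp(\omega\cdot)\|=\min_{u\in\mathcal{U}_n}\|u-\exp(\omega\cdot)\|$; it has exactly $n$ poles. Convergence to $0^+$ means convergence to $0$ through positive values. *)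

theory Defs
  imports
    "HOL-Analysis.Analysis"
    "HOL-Computational_Algebra.Computational_Algebra"
    "HOL-Computational_Algebra.Field_as_Ring"
begin

text \<open>
  Rational functions are elements of the fraction field \<^typ>\<open>complex poly fract\<close>;
  \<^const>\<open>quot_of_fract\<close> yields their irreducible form, with coprime numerator and denominator
  and monic denominator.
\<close>

definition rat_eval :: "complex poly fract \<Rightarrow> complex \<Rightarrow> complex" where
  "rat_eval r z = poly (fst (quot_of_fract r)) z / poly (snd (quot_of_fract r)) z"

definition poles :: "complex poly fract \<Rightarrow> complex multiset" where
  \<comment> \<open>counted with multiplicity\<close>
  "poles r = proots (snd (quot_of_fract r))"

definition dag :: "complex poly \<Rightarrow> complex poly" where
  "dag p = pcompose (map_poly cnj p) [:0, -1:]"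

lemma poly_dag: "poly (dag p) z = cnj (poly p (- cnj z))"
  by (simp add: dag_def poly_pcompose)

definition unitary_rat :: "nat \<Rightarrow> complex poly fract set" where
  "unitary_rat n = {Fraction_Field.Fract (dag p) p | p. degree p \<le> n \<and> p \<noteq> 0}"

text \<open>
  For unitary \<open>r\<close>, \<^term>\<open>rat_eval r\<close> has modulus 1 on the imaginary axis and in particular no pole
  there, so the supremum below is attained, i.e. it is the maximum.
\<close>

definition exp_err :: "real \<Rightarrow> complex poly fract \<Rightarrow> real" where
  "exp_err \<omega> r = (SUP x\<in>{-1..1}. cmod (rat_eval r (\<i> * of_real x) - exp (\<i> * of_real (\<omega> * x))))"

definition best_approx :: "nat \<Rightarrow> real \<Rightarrow> complex poly fract \<Rightarrow> bool" where
  "best_approx n \<omega> r \<longleftrightarrow>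
     r \<in> unitary_rat n \<and> (\<forall>u\<in>unitary_rat n. exp_err \<omega> r \<le> exp_err \<omega> u)"

end

theory Submission
  imports Defs
begin

text \<open>
  For real \<open>x\<close> the point \<open>\<i> x\<close> is fixed by \<open>z \<mapsto> - cnj z\<close>, so that \<open>dag p\<close> takes the value
  \<open>cnj (p (\<i> x))\<close> there. With \<open>Q x = p (\<i> x) * exp (\<i> \<omega> x / 2)\<close> (called \<open>twist\<close> below) the quotient of
  \<open>dag p / p\<close> by \<open>exp (\<i> \<omega> x)\<close> is \<open>cnj (Q x) / Q x\<close>, and the error at \<open>x\<close> is \<open>2 \<bar>Im Q\<bar> / \<bar>Q\<bar>\<close>.
  The error is therefore below its trivial bound \<open>2\<close> on all of \<open>[-1, 1]\<close> exactly if \<open>Re Q\<close> has no zero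
  there, and then one may replace \<open>p\<close> by \<open>- p\<close> to make \<open>Re Q\<close> positive. Two facts about a best
  approximation are needed: its error is below \<open>2\<close>, and it has \<open>n\<close> poles. These
  two determine the limit of the poles.

  \<^emph>\<open>Error below 2.\<close> Let \<open>T\<close> be the polynomial of degree \<open>n\<close> with the roots \<open>\<i> y j\<close>, where
  \<open>y j = (2 j - (n + 1)) \<pi> / \<omega>\<close> (\<open>comb\<close> and \<open>node\<close>). For this limiting choice \<open>Re Q \<ge> 0\<close> on \<open>[-1, 1]\<close>,
  with zeros only at the \<open>y j\<close>, and moving all roots slightly into the right half plane makes \<open>Re Q\<close>
  positive (\<open>exists_unitary_err_less_2\<close>).

  \<^emph>\<open>Degree \<open>n\<close>.\<close> Suppose that \<open>p\<close> is coprime to \<open>dag p\<close> and has degree \<open>m < n\<close>. The derivative of the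
  phase of \<open>Q\<close> is a nonzero polynomial of degree at most \<open>2 m\<close> divided by \<open>\<bar>p\<bar>\<^sup>2\<close>, so the error is
  extremal at no more than \<open>2 m + 2\<close> points of \<open>[-1, 1]\<close>. By coprimality a perturbation of
  \<open>p\<close> of degree at most \<open>m + 1\<close> can change the phase at these points with any prescribed signs, and such a
  perturbation lowers the error (\<open>non_maximal_degree_improvable\<close>).

  \<^emph>\<open>The limit.\<close> Let \<open>\<omega>\<close> tend to \<open>(n + 1) \<pi>\<close> along a sequence. After scaling, the denominators have a
  convergent subsequence; its limit \<open>P\<close> is nonzero with \<open>Re Q \<ge> 0\<close> for \<open>\<omega> = (n + 1) \<pi>\<close>. At the \<open>n + 2\<close>
  equispaced points \<open>-1 + 2 j / (n + 1)\<close> the factor \<open>exp (\<i> \<omega> x / 2)\<close> is a constant times \<open>(-1) ^ j\<close>, so the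
  binomially weighted sum of the values of \<open>Q\<close> is an \<open>(n + 1)\<close>-st finite difference of a polynomial of degree at
  most \<open>n\<close> and vanishes. A sum of nonnegative terms being zero, \<open>Re Q\<close> vanishes at all these points, which forces
  \<open>P\<close> to be a positive multiple of \<open>T\<close> (\<open>Re_twist_nonneg_imp_comb\<close>). Its roots are simple, so the poles converge
  to them, and evaluating \<open>Re Q > 0\<close> at the imaginary part of a pole shows that its real part is
  positive (\<open>positive_twist_roots_converge\<close>).
\<close>

section \<open>Unitary rational functions\<close>

lemma poly_dag_imag: "poly (dag p) (\<i> * of_real x) = cnj (poly p (\<i> * of_real x))"
  by (simp add: poly_dag)

lemma dag_dag [simp]: "dag (dag p) = p"
  by (simp add: poly_eq_poly_eq_iff [symmetric] fun_eq_iff poly_dag)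

lemma dag_add: "dag (p + q) = dag p + dag q"
  and dag_diff: "dag (p - q) = dag p - dag q"
  and dag_mult: "dag (p * q) = dag p * dag q"
  and dag_smult: "dag (smult c p) = smult (cnj c) (dag p)"
  by (simp_all add: poly_eq_poly_eq_iff [symmetric] fun_eq_iff poly_dag)

lemma dag_0 [simp]: "dag 0 = 0"
  by (simp add: dag_def)

lemma dag_eq_0_iff [simp]: "dag p = 0 \<longleftrightarrow> p = 0"
  by (metis dag_0 dag_dag)

lemma degree_dag [simp]: "degree (dag p) = degree p"
  by (simp add: dag_def degree_map_poly degree_pcompose)

lemma rat_eval_Fract:
  assumes "poly b z \<noteq> 0"
  shows "rat_eval (Fraction_Field.Fract a b) z = poly a z / poly b z"
proof -
  let ?q = "quot_of_fract (Fraction_Field.Fract a b)"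
  have b: "b \<noteq> 0" using assms by auto
  have "?q = normalize_quot (a, b)"
    using quot_of_fract_quot_to_fract [of "(a, b)"] b by (simp add: quot_to_fract_def)
  with normalize_quotE [OF b, of a] obtain d where "a = fst ?q * d" "b = snd ?q * d"
    by metis
  then have ab: "poly a z = poly (fst ?q) z * poly d z" "poly b z = poly (snd ?q) z * poly d z"
    by (metis poly_mult)+
  then have "poly d z \<noteq> 0"
    using assms by auto
  then show ?thesis
    unfolding rat_eval_def ab by simp
qed

text \<open>
  A polynomial \<open>q\<close> with \<open>u = dag q / q\<close> may share factors with \<open>dag q\<close>. Cancelling them gives a coprime pair
  \<open>N / D\<close> that satisfies \<open>N * dag N = D * dag D\<close>; coprimality makes \<open>N\<close> a divisor of
  \<open>dag D\<close>, and comparing degrees gives \<open>dag D = c N\<close> with \<open>\<bar>c\<bar> = 1\<close>. A square root of \<open>c\<close> restores the form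
  \<open>dag p / p\<close>.
\<close>
lemma unitary_rat_coprime_form:
  assumes "u \<in> unitary_rat n"
  obtains p where "coprime p (dag p)" "p \<noteq> 0" "degree p \<le> n"
    "u = Fraction_Field.Fract (dag p) p" "poles u = proots p"
proof -
  obtain q where q: "u = Fraction_Field.Fract (dag q) q" "degree q \<le> n" "q \<noteq> 0"
    using assms by (auto simp: unitary_rat_def)
  define N D where "N = fst (quot_of_fract u)" and "D = snd (quot_of_fract u)"
  have "quot_of_fract u = normalize_quot (dag q, q)"
    using quot_of_fract_quot_to_fract [of "(dag q, q)"] q by (simp add: quot_to_fract_def)
  with normalize_quotE [OF q(3), of "dag q"] obtain d where d: "dag q = N * d" "q = D * d" "d \<noteq> 0"
    unfolding N_def D_def by metis
  have cop: "coprime N D"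
    by (simp add: N_def D_def coprime_quot_of_fract)
  have nz: "N \<noteq> 0" "D \<noteq> 0"
    using d q(3) by auto
  have dd: "N * dag N = D * dag D"
  proof -
    have "D * dag d * d * dag D = N * d * (dag N * dag d)"
      by (metis d(1,2) dag_dag dag_mult mult.commute mult.left_commute)
    then have "(N * dag N) * (d * dag d) = (D * dag D) * (d * dag d)"
      by (simp only: mult_ac)
    moreover have "d * dag d \<noteq> 0" using d(3) by simp
    ultimately show ?thesis by (metis mult_right_cancel)
  qed
  have "N dvd dag D"
    using cop dd by (metis coprime_dvd_mult_right_iff dvd_triv_left)
  then obtain k where k: "dag D = N * k" by (elim dvdE)
  have "degree N = degree D"
    by (metis d(1,2) degree_dag degree_mult_eq d(3) nz add_right_cancel)
  then have "degree k = 0" using k nz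
    by (metis add_cancel_left_right degree_0 degree_dag degree_mult_eq)
  then obtain c where c: "k = [:c:]" by (meson degree_eq_zeroE)
  then have DN: "dag D = smult c N" using k by simp
  then have ND: "D = smult (cnj c) (dag N)"
    by (metis dag_dag dag_smult)
  have "c * cnj c = 1"
  proof -
    have "smult (c * cnj c) (N * dag N) = D * dag D"
      unfolding DN by (subst ND) (simp add: mult_ac)
    then have "smult (c * cnj c) (N * dag N) = smult 1 (N * dag N)" using dd by simp
    moreover have "N * dag N \<noteq> 0" using nz by simp
    ultimately show ?thesis
      by (metis diff_eq_diff_eq eq_iff_diff_eq_0 smult_diff_left smult_eq_0_iff)
  qed
  then have "(cmod c)\<^sup>2 = 1"
    by (metis complex_norm_square of_real_eq_1_iff)
  then have nc: "cmod c = 1"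
    by (simp add: power2_eq_1_iff) (smt (verit) norm_ge_zero)
  define w where "w = csqrt c"
  have ww: "w * w = c" by (simp add: w_def flip: power2_eq_square)
  have nw: "cmod w = 1" using nc by (simp add: w_def)
  then have wc: "w * cnj w = 1" by (simp add: complex_norm_square [symmetric])
  have w0: "w \<noteq> 0" using nw by auto
  \<comment> \<open>The unimodular factor \<open>w\<close> splits the constant between numerator and denominator.\<close>
  define p where "p = smult w D"
  have dagp: "dag p = smult w N"
  proof -
    have "dag p = smult (cnj w * c) N" by (simp add: p_def dag_smult DN)
    also have "cnj w * c = w" using wc ww by (metis mult.assoc mult.commute mult_1)
    finally show ?thesis .
  qed
  show ?thesis
  proof (rule that [of p])
    show "coprime p (dag p)"
    proof -
      have "is_unit [:w:]" using w0 by (simp add: is_unit_const_poly_iff dvd_field_iff)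
      then have "coprime ([:w:] * D) ([:w:] * N)"
        using cop unfolding coprime_mult_left_iff coprime_mult_right_iff
        by (meson coprime_commute is_unit_left_imp_coprime is_unit_right_imp_coprime)
      then show ?thesis by (simp add: dagp) (simp add: p_def)
    qed
    show "p \<noteq> 0" using nz w0 by (simp add: p_def)
    show "degree p \<le> n" using q(2) nz d w0 by (simp add: p_def degree_mult_eq)
    show "poles u = proots p" using w0 by (simp add: poles_def p_def D_def)
    have "D * dag q = N * q" using d by (simp add: mult_ac)
    then have "dag q * smult w D = smult w N * q"
      by (simp add: mult_ac)
    then have "dag q * p = dag p * q"
      unfolding p_def [symmetric] dagp [symmetric] .
    then show "u = Fraction_Field.Fract (dag p) p"
      using \<open>p \<noteq> 0\<close> q by (simp add: eq_fract)
  qed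
qed

lemma coprime_dag_imag_nonzero:
  assumes "coprime p (dag p)"
  shows "poly p (\<i> * of_real x) \<noteq> 0"
proof
  assume "poly p (\<i> * of_real x) = 0"
  moreover from this have "poly (dag p) (\<i> * of_real x) = 0"
    by (simp add: poly_dag_imag)
  ultimately show False
    using assms by (meson coprime_poly_0)
qed


section \<open>The phase error on the imaginary axis\<close>

text \<open>
  Multiplying by \<open>exp (\<i> \<omega> x / 2)\<close>, half of the target phase, makes the comparison with \<open>exp (\<i> \<omega> x)\<close> a
  comparison of a complex number with its conjugate.
\<close>
definition twist :: "real \<Rightarrow> complex poly \<Rightarrow> real \<Rightarrow> complex" where
  "twist \<omega> p x = poly p (\<i> * of_real x) * exp (\<i> * of_real (\<omega> * x / 2))"

lemma twist_eq_0_iff: "twist \<omega> p x = 0 \<longleftrightarrow> poly p (\<i> * of_real x) = 0"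
  by (simp add: twist_def)

lemma twist_add: "twist \<omega> (p + q) x = twist \<omega> p x + twist \<omega> q x"
  and twist_diff: "twist \<omega> (p - q) x = twist \<omega> p x - twist \<omega> q x"
  and twist_minus: "twist \<omega> (- p) x = - twist \<omega> p x"
  and twist_smult: "twist \<omega> (smult c p) x = c * twist \<omega> p x"
  by (simp_all add: twist_def algebra_simps)

lemma continuous_on_twist [continuous_intros]: "continuous_on S (twist \<omega> p)"
  unfolding twist_def by (intro continuous_intros) auto

text \<open>
  If \<open>dag p / p\<close> and \<open>exp (\<i> \<omega> x)\<close> differ by the phase \<open>\<theta>\<close> at \<open>\<i> x\<close>, this is \<open>\<bar>sin (\<theta> / 2)\<bar>\<close>.
\<close>
definition phase_sin :: "real \<Rightarrow> complex poly \<Rightarrow> real \<Rightarrow> real" where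
  "phase_sin \<omega> p x = \<bar>Im (twist \<omega> p x)\<bar> / cmod (twist \<omega> p x)"

lemma phase_sin_nonneg: "phase_sin \<omega> p x \<ge> 0"
  by (simp add: phase_sin_def)

lemma unitary_err_at:
  assumes "poly p (\<i> * of_real x) \<noteq> 0"
  shows "cmod (rat_eval (Fraction_Field.Fract (dag p) p) (\<i> * of_real x) - exp (\<i> * of_real (\<omega> * x)))
    = 2 * phase_sin \<omega> p x"
proof -
  define e where "e = exp (\<i> * of_real (\<omega> * x / 2))"
  define P where "P = poly p (\<i> * of_real x)"
  have ee: "exp (\<i> * of_real (\<omega> * x)) = e * e"
    by (simp add: e_def flip: exp_add)
  have ce: "e * cnj e = 1"
    by (simp add: e_def complex_norm_square [symmetric])
  have e1: "cmod e = 1" by (simp add: e_def)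
  have P: "P \<noteq> 0" using assms by (simp add: P_def)
  have "rat_eval (Fraction_Field.Fract (dag p) p) (\<i> * of_real x) - e * e = cnj P / P - e * e"
    using assms by (simp add: rat_eval_Fract poly_dag_imag P_def)
  also have "\<dots> = e * (cnj (P * e) - P * e) / P"
    using P ce by (simp add: field_simps)
  also have "cnj (P * e) - P * e = - (2 * \<i> * of_real (Im (P * e)))"
    by (simp only: complex_eq_iff) simp
  also have "cmod (e * (- (2 * \<i> * of_real (Im (P * e)))) / P) = 2 * (\<bar>Im (P * e)\<bar> / cmod (P * e))"
    by (simp only: norm_mult norm_divide norm_minus_cancel e1 norm_of_real) simp
  finally show ?thesis
    unfolding ee phase_sin_def twist_def e_def [symmetric] P_def [symmetric] .
qed

text \<open>
  The supremum that defines the error is a maximum by compactness. This turns strict pointwise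
  bounds into strict bounds of the error.
\<close>
lemma exp_err_attained:
  assumes nz: "\<And>x. x \<in> {-1..1} \<Longrightarrow> poly p (\<i> * of_real x) \<noteq> 0"
  shows "\<exists>x\<in>{-1..1}. exp_err \<omega> (Fraction_Field.Fract (dag p) p) = 2 * phase_sin \<omega> p x \<and>
    (\<forall>y\<in>{-1..1}. phase_sin \<omega> p y \<le> phase_sin \<omega> p x)"
proof -
  let ?f = "phase_sin \<omega> p"
  have "continuous_on {-1..1} ?f"
    unfolding phase_sin_def using nz by (intro continuous_intros) (auto simp: twist_eq_0_iff)
  then obtain x where x: "x \<in> {-1..1}" "\<And>y. y \<in> {-1..1} \<Longrightarrow> ?f y \<le> ?f x"
    using continuous_attains_sup [of "{-1..1::real}" ?f] by auto
  have "exp_err \<omega> (Fraction_Field.Fract (dag p) p) = (SUP y\<in>{-1..1}. 2 * ?f y)"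
    unfolding exp_err_def by (intro SUP_cong refl unitary_err_at nz)
  also have "\<dots> = 2 * ?f x"
    using x by (intro cSup_eq_maximum) auto
  finally show ?thesis
    using x by blast
qed

lemma Im_div_cmod_less_1_iff:
  assumes "w \<noteq> 0"
  shows "\<bar>Im w\<bar> / cmod w < 1 \<longleftrightarrow> Re w \<noteq> 0"
proof -
  have "\<bar>Im w\<bar> < cmod w \<longleftrightarrow> Re w \<noteq> 0"
  proof
    assume "\<bar>Im w\<bar> < cmod w"
    then show "Re w \<noteq> 0" by (auto simp: cmod_def)
  next
    assume "Re w \<noteq> 0"
    then show "\<bar>Im w\<bar> < cmod w"
      by (auto simp: cmod_def intro!: real_less_rsqrt)
  qed
  then show ?thesis using assms by (simp add: divide_less_eq)
qed

lemma exp_err_less_2I: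
  assumes "\<And>x. x \<in> {-1..1} \<Longrightarrow> Re (twist \<omega> p x) \<noteq> 0"
  shows "exp_err \<omega> (Fraction_Field.Fract (dag p) p) < 2"
proof -
  have nz: "twist \<omega> p x \<noteq> 0" if "x \<in> {-1..1}" for x
    using assms [OF that] by auto
  obtain x where "x \<in> {-1..1}"
    "exp_err \<omega> (Fraction_Field.Fract (dag p) p) = 2 * phase_sin \<omega> p x"
    using exp_err_attained [of p \<omega>] nz unfolding twist_eq_0_iff by blast
  then show ?thesis
    using assms nz Im_div_cmod_less_1_iff [of "twist \<omega> p x"]
    unfolding phase_sin_def [symmetric] by simp
qed

lemma exp_err_less_2D:
  assumes "coprime p (dag p)" "exp_err \<omega> (Fraction_Field.Fract (dag p) p) < 2" "x \<in> {-1..1}"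
  shows "Re (twist \<omega> p x) \<noteq> 0"
proof -
  have nz: "poly p (\<i> * of_real x) \<noteq> 0" for x
    using coprime_dag_imag_nonzero assms(1) by blast
  obtain y where "exp_err \<omega> (Fraction_Field.Fract (dag p) p) = 2 * phase_sin \<omega> p y"
    "phase_sin \<omega> p x \<le> phase_sin \<omega> p y"
    using exp_err_attained [of p \<omega>] nz assms(3) by blast
  then have "phase_sin \<omega> p x < 1"
    using assms(2) by simp
  then show ?thesis
    using nz Im_div_cmod_less_1_iff [of "twist \<omega> p x"] by (simp add: twist_eq_0_iff phase_sin_def)
qed

section \<open>An approximation with error below 2\<close>

text \<open>
  The points at which the line of slope \<open>\<omega>\<close> crosses a staircase function, symmetric about the origin and with
  jumps of height \<open>2 \<pi>\<close>, in the middle of its jumps. For \<open>\<omega> = (n + 1) \<pi>\<close> the indices \<open>0\<close> and \<open>n + 1\<close> give the end points \<open>-1\<close>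
  and \<open>1\<close>, and for smaller \<open>\<omega>\<close> these two lie outside \<open>[-1, 1]\<close>.
\<close>
definition node :: "nat \<Rightarrow> real \<Rightarrow> nat \<Rightarrow> real" where
  "node n \<omega> j = (2 * real j - (real n + 1)) * pi / \<omega>"

text \<open>
  When the \<open>n\<close> roots are moved off the imaginary axis to the right by a small amount, the phase of \<open>dag p / p\<close> along
  the axis is close to that staircase. The factors are \<open>\<i> y - z\<close> rather than \<open>z - \<i> y\<close> so that the twisted values have nonnegative
  real part without a sign depending on \<open>n\<close>.
\<close>
definition comb :: "nat \<Rightarrow> real \<Rightarrow> complex poly" where
  "comb n \<omega> = (\<Prod>j=1..n. [:\<i> * of_real (node n \<omega> j), -1:])"

lemma comb_nonzero [simp]: "comb n \<omega> \<noteq> 0"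
  by (simp add: comb_def)

lemma degree_comb [simp]: "degree (comb n \<omega>) = n"
  by (simp add: comb_def degree_prod_eq_sum_degree)

text \<open>
  The linear factors change sign at the same points as the sine. The induction on \<open>n\<close> either multiplies by a
  further positive factor or, beyond \<open>n + 1\<close>, shifts \<open>t\<close> by one.
\<close>
lemma sin_times_linear_factors_pos:
  assumes "0 < t" "t < real n + 1" "t \<notin> \<int>"
  shows "0 < (\<Prod>j=1..n. real j - t) * sin (pi * t)"
  using assms
proof (induction n arbitrary: t)
  case 0
  then show ?case by (simp add: sin_gt_zero)
next
  case (Suc n)
  have "t \<noteq> real n + 1"
    using Suc.prems(3) by (metis Ints_1 Ints_add Ints_of_nat)
  then consider "t < real n + 1" | "t > real n + 1" by linarith
  then show ?case
  proof cases
    case 1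
    then have "0 < (\<Prod>j=1..n. real j - t) * sin (pi * t)"
      using Suc by blast
    moreover have "0 < real (Suc n) - t"
      using 1 by simp
    ultimately have "0 < ((\<Prod>j=1..n. real j - t) * sin (pi * t)) * (real (Suc n) - t)"
      by (rule mult_pos_pos)
    then show ?thesis by (simp add: mult_ac)
  next
    case 2
    have "(\<Prod>j=1..Suc n. real j - t) = (1 - t) * (\<Prod>j=Suc 1..Suc n. real j - t)"
      by (subst prod.atLeast_Suc_atMost) auto
    also have "(\<Prod>j=Suc 1..Suc n. real j - t) = (\<Prod>j=1..n. real (Suc j) - t)"
      by (rule prod.shift_bounds_cl_Suc_ivl)
    also have "(\<lambda>j. real (Suc j) - t) = (\<lambda>j. real j - (t - 1))"
      by auto
    finally have P: "(\<Prod>j=1..Suc n. real j - t) = (1 - t) * (\<Prod>j=1..n. real j - (t - 1))" .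
    have S: "sin (pi * t) = - sin (pi * (t - 1))"
      by (simp add: right_diff_distrib sin_diff)
    have "(\<Prod>j=1..Suc n. real j - t) * sin (pi * t)
        = (t - 1) * ((\<Prod>j=1..n. real j - (t - 1)) * sin (pi * (t - 1)))"
      unfolding P S by (simp only: algebra_simps)
    moreover have "0 < (\<Prod>j=1..n. real j - (t - 1)) * sin (pi * (t - 1))"
      using 2 Suc.prems by (intro Suc.IH) (auto dest: Ints_add [OF _ Ints_1])
    ultimately show ?thesis using 2 by simp
  qed
qed


text \<open>
  Measured in the variable \<open>t\<close>, in which the nodes are the integers, the twist is \<open>exp (\<i> \<pi> t)\<close> up to \<open>n + 1\<close>
  quarter turns.
\<close>
lemma exp_quarter_turns:
  assumes "\<omega> * x / 2 = pi * (t - (real n + 1) / 2)"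
  shows "exp (\<i> * of_real (\<omega> * x / 2)) = exp (\<i> * of_real (pi * t)) * (- \<i>) ^ (n + 1)"
proof -
  have m: "exp (\<i> * of_real (- (pi / 2))) = - \<i>"
    unfolding cis_conv_exp [symmetric] by (simp add: complex_eq_iff)
  have "\<i> * of_real (\<omega> * x / 2)
      = \<i> * of_real (pi * t) + of_nat (n + 1) * (\<i> * of_real (- (pi / 2)))"
    unfolding assms by (simp add: algebra_simps add_divide_distrib)
  then show ?thesis
    by (simp only: exp_add exp_of_nat_mult m)
qed

lemma I_power_cancel: "\<i> ^ k * (- \<i>) ^ k = 1"
  by (simp flip: power_mult_distrib)

lemma node_diff:
  assumes "\<omega> > 0"
  shows "node n \<omega> j - x = 2 * pi / \<omega> * (real j - (\<omega> * x / pi + (real n + 1)) / 2)"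
proof -
  have "2 * pi / \<omega> * (real j - (\<omega> * x / pi + (real n + 1)) / 2)
      = (2 * real j - (real n + 1)) * (pi / \<omega>) - \<omega> * x / pi * (pi / \<omega>)"
    by (simp add: algebra_simps)
  also have "\<omega> * x / pi * (pi / \<omega>) = x"
    using assms by simp
  finally show ?thesis by (simp add: node_def)
qed

lemma node_diff_node:
  "node n \<omega> k - node n \<omega> j = 2 * pi / \<omega> * (real k - real j)"
  by (simp add: node_def algebra_simps flip: diff_divide_distrib)

lemma imag_diff: "\<i> * of_real a - \<i> * of_real b = \<i> * of_real (a - b)"
  by (simp add: right_diff_distrib)

lemma twist_comb:
  fixes n :: nat and \<omega> :: real
  assumes "\<omega> > 0"
  defines "t \<equiv> \<lambda>x. (\<omega> * x / pi + (real n + 1)) / 2"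
  shows "twist \<omega> (comb n \<omega>) x
    = - \<i> * of_real ((2 * pi / \<omega>) ^ n * (\<Prod>j=1..n. real j - t x)) * exp (\<i> * of_real (pi * t x))"
proof -
  have e: "exp (\<i> * of_real (\<omega> * x / 2)) = exp (\<i> * of_real (pi * t x)) * (- \<i>) ^ (n + 1)"
    by (rule exp_quarter_turns) (simp add: t_def add_divide_distrib)
  have "poly (comb n \<omega>) (\<i> * of_real x) = (\<Prod>j=1..n. \<i> * of_real (2 * pi / \<omega> * (real j - t x)))"
  proof -
    have "poly [:\<i> * of_real (node n \<omega> j), -1:] (\<i> * of_real x) = \<i> * of_real (2 * pi / \<omega> * (real j - t x))" for j
      unfolding t_def node_diff [OF assms(1), symmetric] by (simp add: imag_diff)
    then show ?thesis unfolding comb_def poly_prod by simp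
  qed
  also have "\<dots> = \<i> ^ n * of_real ((2 * pi / \<omega>) ^ n * (\<Prod>j=1..n. real j - t x))"
    by (simp only: prod.distrib of_real_mult prod_constant of_real_prod of_real_power) simp
  finally show ?thesis
    unfolding twist_def e using I_power_cancel [of n] by simp
qed

lemma Re_twist_comb:
  assumes "\<omega> > 0"
  shows "Re (twist \<omega> (comb n \<omega>) x) = (2 * pi / \<omega>) ^ n *
    ((\<Prod>j=1..n. real j - (\<omega> * x / pi + (real n + 1)) / 2) * sin (pi * ((\<omega> * x / pi + (real n + 1)) / 2)))"
proof -
  have "Re (- \<i> * of_real a * exp (\<i> * of_real b)) = a * sin b" for a b :: real
    unfolding cis_conv_exp [symmetric] by simp
  then show ?thesis
    unfolding twist_comb [OF assms] mult.assoc [symmetric] .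
qed

lemma prod_diff_omit_sign:
  assumes "j \<in> {1..n}"
  shows "(\<Prod>k\<in>{1..n}-{j}. real k - real j) = (-1) ^ (j - 1) * (\<Prod>k\<in>{1..n}-{j}. \<bar>real k - real j\<bar>)"
proof -
  have split: "{1..n}-{j} = {1..<j} \<union> {j<..n}" "{1..<j} \<inter> {j<..n} = {}"
    using assms by auto
  have "(\<Prod>k\<in>{1..<j}. real k - real j) = (\<Prod>k\<in>{1..<j}. (-1) * \<bar>real k - real j\<bar>)"
    by (intro prod.cong) auto
  also have "\<dots> = (-1) ^ (j - 1) * (\<Prod>k\<in>{1..<j}. \<bar>real k - real j\<bar>)"
    by (simp only: prod.distrib) simp
  finally have l: "(\<Prod>k\<in>{1..<j}. real k - real j) = (-1) ^ (j - 1) * (\<Prod>k\<in>{1..<j}. \<bar>real k - real j\<bar>)" .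
  have r: "(\<Prod>k\<in>{j<..n}. real k - real j) = (\<Prod>k\<in>{j<..n}. \<bar>real k - real j\<bar>)"
    by (intro prod.cong) auto
  show ?thesis
    unfolding split(1) by (subst (1 2) prod.union_disjoint) (use split(2) l r in auto)
qed

lemma exp_at_node:
  assumes "\<omega> > 0"
  shows "exp (\<i> * of_real (\<omega> * node n \<omega> j / 2)) = (-1) ^ j * (- \<i>) ^ (n + 1)"
proof -
  have e: "exp (\<i> * of_real (\<omega> * node n \<omega> j / 2)) = exp (\<i> * of_real (pi * real j)) * (- \<i>) ^ (n + 1)"
    by (rule exp_quarter_turns) (use assms in \<open>simp add: node_def diff_divide_distrib\<close>)
  have "exp (\<i> * of_real (pi * real j)) = cis (real j * pi)"
    by (simp only: cis_conv_exp mult.commute [of pi])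
  also have "\<dots> = (-1) ^ j"
    using Complex.DeMoivre [of pi j] by (metis cis_pi)
  finally show ?thesis using e by simp
qed

text \<open>
  Up to sign, this is the derivative of \<open>comb n \<omega>\<close> at a node, twisted. That it is
  positive decides twice on which side of the imaginary axis a root near the node may lie: here it shows that
  shifting the roots to the right makes the real part positive, and in the limit argument it shows that only the
  right-hand side is possible.
\<close>
lemma node_factor_positive:
  assumes "\<omega> > 0" "j \<in> {1..n}"
  shows "\<exists>c>0. (\<Prod>k\<in>{1..n}-{j}. \<i> * of_real (node n \<omega> k) - \<i> * of_real (node n \<omega> j))
       * exp (\<i> * of_real (\<omega> * node n \<omega> j / 2)) = of_real c"
proof -
  let ?K = "{1..n}-{j}"
  have "(- \<i>) ^ (n + 1) = (- \<i>) ^ (n - 1) * (- 1)"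
    using assms by (cases n) simp_all
  then have e': "exp (\<i> * of_real (\<omega> * node n \<omega> j / 2)) = (-1) ^ (j - 1) * (- \<i>) ^ (n - 1)"
    unfolding exp_at_node [OF assms(1)] using assms by (cases j) simp_all
  have card: "card ?K = n - 1" using assms by simp
  have "(\<Prod>k\<in>?K. \<i> * of_real (node n \<omega> k) - \<i> * of_real (node n \<omega> j))
      = (\<Prod>k\<in>?K. \<i> * of_real (2 * pi / \<omega> * (real k - real j)))"
    unfolding imag_diff node_diff_node ..
  also have "\<dots> = \<i> ^ (n - 1) * of_real ((2 * pi / \<omega>) ^ (n - 1) * (\<Prod>k\<in>?K. real k - real j))"
    by (simp only: prod.distrib of_real_mult prod_constant card of_real_prod of_real_power mult.assoc)
  also have "\<dots> = \<i> ^ (n - 1) * (-1) ^ (j - 1)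
      * of_real ((2 * pi / \<omega>) ^ (n - 1) * (\<Prod>k\<in>?K. \<bar>real k - real j\<bar>))"
    unfolding prod_diff_omit_sign [OF assms(2)] by simp
  finally have *: "(\<Prod>k\<in>?K. \<i> * of_real (node n \<omega> k) - \<i> * of_real (node n \<omega> j)) = \<dots>" .
  have sq: "(-1) ^ (j - 1) * (-1) ^ (j - 1) = (1::complex)"
    by (simp flip: power_mult_distrib)
  have "(\<Prod>k\<in>?K. \<i> * of_real (node n \<omega> k) - \<i> * of_real (node n \<omega> j))
       * exp (\<i> * of_real (\<omega> * node n \<omega> j / 2))
     = of_real ((2 * pi / \<omega>) ^ (n - 1) * (\<Prod>k\<in>?K. \<bar>real k - real j\<bar>))"
    unfolding * e' using I_power_cancel [of "n - 1"] sq by (simp only: mult_ac) (simp add: mult.left_commute)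
  moreover have "(2 * pi / \<omega>) ^ (n - 1) * (\<Prod>k\<in>?K. \<bar>real k - real j\<bar>) > 0"
    using assms by (intro mult_pos_pos prod_pos) auto
  ultimately show ?thesis by blast
qed

text \<open>
  A nonnegative function on a compact set becomes positive under a small perturbation whose first-order term is positive
  at its zeros: for violating points with \<open>t\<close> tending to \<open>0\<close>, any limit point is a zero at which the first-order term is
  not positive.
\<close>
lemma compact_perturbation_pos:
  fixes f g h :: "'a::metric_space \<Rightarrow> real"
  assumes "compact S" "continuous_on S f" "continuous_on S g" "continuous_on S h"
    and f: "\<And>x. x \<in> S \<Longrightarrow> f x \<ge> 0"
    and g: "\<And>x. x \<in> S \<Longrightarrow> f x = 0 \<Longrightarrow> g x > 0"
  shows "\<exists>t>0. \<forall>x\<in>S. f x + t * g x + t\<^sup>2 * h x > 0"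
proof (rule ccontr)
  define t where "t = (\<lambda>k::nat. inverse (real (Suc k)))"
  assume "\<not> ?thesis"
  then have "\<exists>x\<in>S. f x + t k * g x + (t k)\<^sup>2 * h x \<le> 0" for k
    unfolding t_def by (metis inverse_positive_iff_positive not_less of_nat_0_less_iff zero_less_Suc)
  then obtain X where X: "\<And>k. X k \<in> S" "\<And>k. f (X k) + t k * g (X k) + (t k)\<^sup>2 * h (X k) \<le> 0"
    by metis
  obtain l \<phi> where l: "l \<in> S" "strict_mono \<phi>" "(X \<circ> \<phi>) \<longlonglongrightarrow> l"
    using \<open>compact S\<close> X(1) unfolding compact_def by blast
  have lim: "(\<lambda>k. q (X (\<phi> k))) \<longlonglongrightarrow> q l" if "continuous_on S q" for q :: "'a \<Rightarrow> real"
    using continuous_on_tendsto_compose [OF that l(3) l(1)] X(1) by (simp add: o_def)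
  have t0: "(\<lambda>k. t (\<phi> k)) \<longlonglongrightarrow> 0"
    using LIMSEQ_subseq_LIMSEQ [OF LIMSEQ_inverse_real_of_nat l(2)] by (simp add: o_def t_def)
  have tpos: "t k > 0" for k by (simp add: t_def)
  have "(\<lambda>k. f (X (\<phi> k)) + t (\<phi> k) * g (X (\<phi> k)) + (t (\<phi> k))\<^sup>2 * h (X (\<phi> k)))
      \<longlonglongrightarrow> f l + 0 * g l + 0\<^sup>2 * h l"
    by (intro tendsto_intros lim t0 assms)
  then have "f l \<le> 0"
    using X(2) by (intro LIMSEQ_le_const2 [where X = "\<lambda>k. f (X (\<phi> k)) + t (\<phi> k) * g (X (\<phi> k)) + (t (\<phi> k))\<^sup>2 * h (X (\<phi> k))"]) auto
  then have "g l > 0" using f g l(1) by (simp add: antisym)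
  have "g (X k) + t k * h (X k) \<le> 0" for k
  proof -
    have "t k * (g (X k) + t k * h (X k)) \<le> 0"
      using X(2) [of k] f [OF X(1) [of k]] by (simp add: power2_eq_square algebra_simps)
    then show ?thesis using tpos [of k] by (simp add: mult_le_0_iff)
  qed
  moreover have "(\<lambda>k. g (X (\<phi> k)) + t (\<phi> k) * h (X (\<phi> k))) \<longlonglongrightarrow> g l + 0 * h l"
    by (intro tendsto_intros lim t0 assms)
  ultimately have "g l + 0 * h l \<le> 0"
    by (intro LIMSEQ_le_const2 [where X = "\<lambda>k. g (X (\<phi> k)) + t (\<phi> k) * h (X (\<phi> k))"]) auto
  then show False using \<open>g l > 0\<close> by simp
qed

lemma poly_pderiv_comb_node:
  assumes "j \<in> {1..n}"
  shows "poly (pderiv (comb n \<omega>)) (\<i> * of_real (node n \<omega> j))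
    = - (\<Prod>k\<in>{1..n}-{j}. \<i> * of_real (node n \<omega> k) - \<i> * of_real (node n \<omega> j))"
proof -
  let ?z = "\<i> * of_real (node n \<omega> j)"
  have "poly (pderiv (comb n \<omega>)) ?z
     = (\<Sum>i\<in>{1..n}. - (\<Prod>k\<in>{1..n}-{i}. \<i> * of_real (node n \<omega> k) - ?z))"
    unfolding comb_def pderiv_prod by (simp add: poly_sum poly_prod pderiv_pCons)
  also have "\<dots> = (\<Sum>i\<in>{j}. - (\<Prod>k\<in>{1..n}-{i}. \<i> * of_real (node n \<omega> k) - ?z))"
    by (intro sum.mono_neutral_right) (use assms in \<open>auto intro!: prod_zero\<close>)
  finally show ?thesis by simp
qed

text \<open>
  The denominator is \<open>T - \<delta> T'\<close> with \<open>T = comb n \<omega>\<close>, which is to first order the shift \<open>T (z - \<delta>)\<close> of all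
  roots by \<open>\<delta>\<close> to the right. The bound on \<open>\<omega>\<close> keeps \<open>[-1, 1]\<close> strictly between the outer nodes
  \<open>0\<close> and \<open>n + 1\<close>.
\<close>
lemma exists_unitary_err_less_2:
  assumes \<omega>: "0 < \<omega>" "\<omega> < (real n + 1) * pi"
  shows "\<exists>u\<in>unitary_rat n. exp_err \<omega> u < 2"
proof -
  define T where "T = comb n \<omega>"
  define t where "t = (\<lambda>x. (\<omega> * x / pi + (real n + 1)) / 2)"
  have t: "0 < t x" "t x < real n + 1" if "x \<in> {-1..1}" for x
  proof -
    have "\<bar>\<omega> * x\<bar> \<le> \<omega> * 1"
      unfolding abs_mult using that \<omega> by (intro mult_mono) auto
    then have "\<bar>\<omega> * x\<bar> < (real n + 1) * pi" using \<omega> by linarith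
    then have "\<bar>\<omega> * x / pi\<bar> < real n + 1" by (simp add: divide_less_eq)
    then have "0 < \<omega> * x / pi + (real n + 1)" "\<omega> * x / pi < real n + 1" by linarith+
    then show "0 < t x" "t x < real n + 1" unfolding t_def by simp_all
  qed
  have Re: "Re (twist \<omega> T x) = (2 * pi / \<omega>) ^ n * ((\<Prod>j=1..n. real j - t x) * sin (pi * t x))" for x
    unfolding T_def t_def by (rule Re_twist_comb [OF \<omega>(1)])
  have noninteger: "Re (twist \<omega> T x) > 0" if "x \<in> {-1..1}" "t x \<notin> \<int>" for x
    unfolding Re using that t \<omega> by (intro mult_pos_pos sin_times_linear_factors_pos) auto
  have integer: "\<exists>j\<in>{1..n}. x = node n \<omega> j" if x: "x \<in> {-1..1}" and tx: "t x \<in> \<int>" for x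
  proof -
    obtain i where i: "t x = of_int i" using tx by (elim Ints_cases)
    then have "0 < i" "i < int n + 1" using t [OF x] by linarith+
    then have "nat i \<in> {1..n}" by auto
    moreover have "x = node n \<omega> (nat i)"
      using node_diff [OF \<omega>(1), of n "nat i" x] i \<open>0 < i\<close> unfolding t_def by simp
    ultimately show ?thesis by blast
  qed
  have node0: "Re (twist \<omega> T (node n \<omega> j)) = 0" if "j \<in> {1..n}" for j
  proof -
    have "poly (comb n \<omega>) (\<i> * of_real (node n \<omega> j)) = 0"
      unfolding comb_def poly_prod using that by (intro prod_zero bexI [of _ j]) auto
    then show ?thesis by (simp add: T_def twist_def)
  qed
  have "\<exists>\<delta>>0. \<forall>x\<in>{-1..1}. Re (twist \<omega> T x) + \<delta> * Re (twist \<omega> (- pderiv T) x) + \<delta>\<^sup>2 * 0 > 0"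
  proof (rule compact_perturbation_pos)
    fix x :: real assume x: "x \<in> {-1..1}"
    show "Re (twist \<omega> T x) \<ge> 0"
      using noninteger [OF x] integer [OF x] node0 by (metis less_eq_real_def)
    assume "Re (twist \<omega> T x) = 0"
    then obtain j where j: "j \<in> {1..n}" "x = node n \<omega> j"
      using noninteger [OF x] integer [OF x] by force
    obtain c where c: "c > 0"
      "(\<Prod>k\<in>{1..n}-{j}. \<i> * of_real (node n \<omega> k) - \<i> * of_real (node n \<omega> j))
       * exp (\<i> * of_real (\<omega> * node n \<omega> j / 2)) = of_real c"
      using node_factor_positive [OF \<omega>(1) j(1)] by blast
    have "twist \<omega> (- pderiv T) x = of_real c"
    proof -
      have "poly (pderiv T) (\<i> * of_real x)
          = - (\<Prod>k\<in>{1..n}-{j}. \<i> * of_real (node n \<omega> k) - \<i> * of_real (node n \<omega> j))"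
        unfolding T_def j(2) by (rule poly_pderiv_comb_node [OF j(1)])
      then show ?thesis
        unfolding twist_minus twist_def j(2) c(2) [symmetric] by simp
    qed
    then show "Re (twist \<omega> (- pderiv T) x) > 0" using c(1) by simp
  qed (intro compact_Icc continuous_intros)+
  then obtain \<delta> where \<delta>: "\<And>x. x \<in> {-1..1} \<Longrightarrow> Re (twist \<omega> (T - smult (of_real \<delta>) (pderiv T)) x) > 0"
    by (force simp: twist_diff twist_minus twist_smult)
  define p where "p = T - smult (of_real \<delta>) (pderiv T)"
  have "degree p \<le> n"
    unfolding p_def by (intro degree_diff_le) (auto simp: T_def degree_pderiv intro: order_trans [OF degree_smult_le])
  moreover have "p \<noteq> 0"
    using \<delta> [of 0] by (auto simp: p_def [symmetric] twist_def)
  moreover have "exp_err \<omega> (Fraction_Field.Fract (dag p) p) < 2"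
    using \<delta> unfolding p_def by (intro exp_err_less_2I) fastforce
  ultimately show ?thesis by (auto simp: unitary_rat_def)
qed

section \<open>Best approximations have full degree\<close>

lemma poly_interpolation:
  fixes f :: "'a::field \<Rightarrow> 'a"
  assumes "finite X"
  shows "\<exists>G. degree G \<le> card X - 1 \<and> (\<forall>x\<in>X. poly G x = f x)"
  using assms
proof (induction X rule: finite_induct)
  case empty
  then show ?case by (intro exI [of _ 0]) simp
next
  case (insert a X)
  then obtain G where G: "degree G \<le> card X - 1" "\<And>x. x \<in> X \<Longrightarrow> poly G x = f x"
    by blast
  define L where "L = (\<Prod>y\<in>X. [:- y, 1:])"
  have L: "poly L x = (\<Prod>y\<in>X. x - y)" for x
    by (simp add: L_def poly_prod)
  have La: "poly L a \<noteq> 0" and LX: "x \<in> X \<Longrightarrow> poly L x = 0" for x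
    using insert.hyps by (auto simp: L)
  have dL: "degree L = card X"
    by (simp add: L_def degree_prod_eq_sum_degree)
  let ?G = "G + smult ((f a - poly G a) / poly L a) L"
  have "degree ?G \<le> card (insert a X) - 1"
    using G(1) insert.hyps by (intro degree_add_le order_trans [OF degree_smult_le]) (auto simp: dL)
  moreover have "\<forall>x\<in>insert a X. poly ?G x = f x"
    using La LX G(2) by auto
  ultimately show ?case by blast
qed

text \<open>
  Polynomials with \<open>dag H = - H\<close> are those with purely imaginary values on the imaginary axis. Interpolating
  arbitrarily and taking the antisymmetric part retains the imaginary values and the degree.
\<close>
lemma antisymmetric_interpolation:
  fixes h :: "real \<Rightarrow> real"
  assumes "finite X"
  shows "\<exists>H. dag H = - H \<and> degree H \<le> card X - 1 \<and> (\<forall>x\<in>X. poly H (\<i> * of_real x) = 2 * \<i> * of_real (h x))"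
proof -
  define Y where "Y = (\<lambda>x. \<i> * complex_of_real x) ` X"
  have "finite Y" "card Y = card X"
    unfolding Y_def using assms by (auto intro!: card_image inj_onI)
  then obtain G where G: "degree G \<le> card X - 1" "\<And>z. z \<in> Y \<Longrightarrow> poly G z = 2 * \<i> * of_real (h (Im z))"
    using poly_interpolation [of Y "\<lambda>z. 2 * \<i> * of_real (h (Im z))"] by auto
  define H where "H = smult (1/2) (G - dag G)"
  have "dag H = - H"
    by (simp add: H_def dag_smult dag_diff flip: smult_minus_right)
  moreover have "degree H \<le> card X - 1"
    unfolding H_def using G(1) by (intro order_trans [OF degree_smult_le] degree_diff_le) auto
  moreover have "poly H (\<i> * of_real x) = 2 * \<i> * of_real (h x)" if "x \<in> X" for x
  proof -
    have "poly G (\<i> * of_real x) = 2 * \<i> * of_real (h x)"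
      using G(2) [of "\<i> * of_real x"] that by (simp add: Y_def)
    then show ?thesis by (simp add: H_def poly_dag_imag)
  qed
  ultimately show ?thesis by blast
qed

text \<open>
  On the imaginary axis the left-hand side is \<open>2 \<i> Im (d * cnj p)\<close>, which is proportional to the first-order change of
  the phase when \<open>p\<close> moves in direction \<open>d\<close>. A Bezout identity for \<open>p\<close> and \<open>dag p\<close> gives a solution \<open>d0\<close>, by
  antisymmetrisation. Adding to \<open>d0\<close> a product \<open>g * p\<close> with \<open>dag g = g\<close> changes nothing; so only
  the antisymmetric part \<open>g2\<close> of the quotient \<open>d0 div p\<close> has to be kept, and its degree is controlled by that of \<open>H\<close>.
\<close>
lemma solve_tangent_equation:
  assumes cop: "coprime p (dag p)" and p: "p \<noteq> 0"
    and H: "dag H = - H" "degree H \<le> 2 * degree p + 1"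
  shows "\<exists>d. degree d \<le> degree p + 1 \<and> d * dag p - dag d * p = H"
proof -
  let ?c = "bezout_coefficients p (dag p)"
  have "fst ?c * p + snd ?c * dag p = 1"
    using cop by (simp add: bezout_coefficients_fst_snd)
  define a b where "a = H * snd ?c" and "b = H * fst ?c"
  have Hab: "H = a * dag p + b * p"
  proof -
    have "H = H * (fst ?c * p + snd ?c * dag p)"
      using cop by (simp add: bezout_coefficients_fst_snd)
    then show ?thesis by (simp add: a_def b_def algebra_simps)
  qed
  have dagH: "dag H = dag a * p + dag b * dag p"
    unfolding Hab by (simp add: dag_add dag_mult)
  define d0 where "d0 = smult (1/2) (a - dag b)"
  have "d0 * dag p - dag d0 * p = smult (1/2) (H - dag H)"
    unfolding dagH by (subst Hab)
      (simp add: d0_def dag_smult dag_diff algebra_simps smult_diff_right smult_add_right)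
  also have "\<dots> = H"
    unfolding H(1) by (simp add: poly_eq_poly_eq_iff [symmetric] fun_eq_iff)
  finally have d0: "d0 * dag p - dag d0 * p = H" .
  \<comment> \<open>Only the antisymmetric part of the quotient contributes to the equation.\<close>
  define g s where "g = d0 div p" and "s = d0 mod p"
  have "d0 = g * p + s" by (simp add: g_def s_def)
  define g2 where "g2 = smult (1/2) (g - dag g)"
  have dag_g2: "dag g2 = - g2"
    by (simp add: g2_def dag_smult dag_diff flip: smult_minus_right)
  have gg: "g - dag g = 2 * g2"
    by (simp add: g2_def poly_eq_poly_eq_iff [symmetric] fun_eq_iff)
  define d where "d = s + g2 * p"
  have ds: "degree s \<le> degree p"
    using degree_mod_less' [of p d0] p by (cases "s = 0") (auto simp: s_def)
  have "d0 * dag p - dag d0 * p = (s * dag p - dag s * p) + (g - dag g) * (p * dag p)"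
    unfolding \<open>d0 = g * p + s\<close> by (simp add: dag_add dag_mult algebra_simps)
  then have H2: "H = (s * dag p - dag s * p) + 2 * g2 * (p * dag p)"
    unfolding d0 gg by simp
  have "d * dag p - dag d * p = H"
    unfolding H2 d_def by (simp add: dag_add dag_mult dag_g2 algebra_simps)
  moreover have "degree d \<le> degree p + 1"
  proof (cases "g2 = 0")
    case True
    then show ?thesis using ds by (simp add: d_def)
  next
    case False
    have "degree (s * dag p - dag s * p) \<le> 2 * degree p"
      using ds by (intro degree_diff_le order_trans [OF degree_mult_le]) auto
    then have "degree (H - (s * dag p - dag s * p)) \<le> 2 * degree p + 1"
      using degree_diff_le [OF H(2), of "s * dag p - dag s * p"] by simp
    moreover have "H - (s * dag p - dag s * p) = smult 2 (g2 * (p * dag p))"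
      unfolding H2 by (simp add: poly_eq_poly_eq_iff [symmetric] fun_eq_iff)
    ultimately have "degree (g2 * (p * dag p)) \<le> 2 * degree p + 1" by simp
    then have "degree g2 \<le> 1"
      using False p by (simp add: degree_mult_eq)
    then have "degree (g2 * p) \<le> degree p + 1"
      by (intro order_trans [OF degree_mult_le]) auto
    then show ?thesis
      unfolding d_def using ds by (intro degree_add_le) auto
  qed
  ultimately show ?thesis by blast
qed

text \<open>
  On the imaginary axis this is \<open>\<bar>p\<bar>\<^sup>2\<close> times the derivative of the phase of \<open>twist \<omega> p\<close>.
\<close>
definition phase_speed :: "real \<Rightarrow> complex poly \<Rightarrow> complex poly" where
  "phase_speed \<omega> p = smult (1/2) (pderiv p * dag p + dag (pderiv p) * p) + smult (of_real (\<omega> / 2)) (p * dag p)"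

lemma degree_phase_speed: "degree (phase_speed \<omega> p) \<le> 2 * degree p"
  unfolding phase_speed_def
  by (intro degree_add_le order_trans [OF degree_smult_le] order_trans [OF degree_mult_le])
     (auto simp: degree_pderiv)

text \<open>
  The summand \<open>\<omega> / 2 * p * dag p\<close> has degree \<open>2 * degree p\<close> and dominates the summands with a derivative of
  \<open>p\<close>.
\<close>
lemma phase_speed_nonzero:
  assumes "\<omega> \<noteq> 0" "p \<noteq> 0"
  shows "phase_speed \<omega> p \<noteq> 0"
proof -
  let ?m = "degree p"
  have z: "coeff (pderiv p * dag p + dag (pderiv p) * p) (?m + ?m) = 0"
  proof (cases "?m = 0")
    case True
    then have "pderiv p = 0" by (simp add: pderiv_eq_0_iff)
    then show ?thesis by simp
  next
    case False
    then have "degree (pderiv p * dag p + dag (pderiv p) * p) < ?m + ?m"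
      by (intro degree_add_less le_less_trans [OF degree_mult_le]) (auto simp: degree_pderiv)
    then show ?thesis by (rule coeff_eq_0)
  qed
  have "coeff (phase_speed \<omega> p) (?m + ?m) = of_real (\<omega> / 2) * (lead_coeff p * lead_coeff (dag p))"
    using coeff_mult_degree_sum [of p "dag p"] z unfolding phase_speed_def by simp
  also have "\<dots> \<noteq> 0"
    using assms leading_coeff_0_iff [of "dag p"] by simp
  finally show ?thesis by auto
qed

lemma poly_phase_speed:
  "poly (phase_speed \<omega> p) (\<i> * of_real x) =
    of_real (Re (cnj (twist \<omega> p x) * twist \<omega> (pderiv p + smult (of_real (\<omega> / 2)) p) x))"
proof -
  define e P D where "e = exp (\<i> * of_real (\<omega> * x / 2))"
    and "P = poly p (\<i> * of_real x)" and "D = poly (pderiv p) (\<i> * of_real x)"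
  have ce: "cnj e * e = 1"
    by (simp add: e_def complex_norm_square [symmetric] mult.commute)
  have "cnj (twist \<omega> p x) * twist \<omega> (pderiv p + smult (of_real (\<omega> / 2)) p) x
      = (cnj e * e) * (cnj P * (D + of_real (\<omega> / 2) * P))"
    by (simp add: twist_def e_def P_def D_def algebra_simps)
  also have "\<dots> = cnj P * (D + of_real (\<omega> / 2) * P)" by (simp add: ce)
  finally have R: "Re (cnj (twist \<omega> p x) * twist \<omega> (pderiv p + smult (of_real (\<omega> / 2)) p) x)
      = Re (cnj P * (D + of_real (\<omega> / 2) * P))" by simp
  have "poly (phase_speed \<omega> p) (\<i> * of_real x)
      = (D * cnj P + cnj D * P) / 2 + of_real (\<omega> / 2) * (P * cnj P)"
    by (simp add: phase_speed_def poly_dag_imag P_def D_def)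
  also have "\<dots> = of_real (Re (cnj P * (D + of_real (\<omega> / 2) * P)))"
    by (simp add: complex_eq_iff algebra_simps)
  finally show ?thesis unfolding R .
qed

lemma twist_has_vector_derivative:
  "(twist \<omega> p has_vector_derivative \<i> * twist \<omega> (pderiv p + smult (of_real (\<omega> / 2)) p) x) (at x)"
proof -
  have "((\<lambda>z. poly p (\<i> * z) * exp (\<i> * (of_real \<omega> * z / 2))) has_field_derivative
      \<i> * (poly (pderiv p + smult (of_real (\<omega> / 2)) p) (\<i> * of_real x) * exp (\<i> * (of_real \<omega> * of_real x / 2))))
      (at (of_real x))"
    by (rule derivative_eq_intros refl DERIV_chain' [OF _ poly_DERIV] | simp add: algebra_simps)+
  from has_vector_derivative_real_field [OF this] show ?thesis
    by (simp add: twist_def [abs_def])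
qed

text \<open>
  With \<open>twist \<omega> p = A + \<i> B\<close>, maximality at \<open>x\<close> says that \<open>B y ^ 2 * A x ^ 2 - B x ^ 2 * A y ^ 2\<close> is maximal at
  \<open>y = x\<close>. Its derivative there is \<open>2 A B (A B' - B A')\<close>, and \<open>A B' - B A'\<close> is the value of \<open>phase_speed\<close>. If
  \<open>B x = 0\<close>, the error is zero throughout, hence \<open>B\<close> vanishes identically on \<open>[-1, 1]\<close> and \<open>B' = 0\<close>.
\<close>
lemma interior_extremum_phase_speed:
  assumes x: "x \<in> {-1<..<1}" and A: "Re (twist \<omega> p x) \<noteq> 0"
    and max: "\<And>y. y \<in> {-1..1} \<Longrightarrow> phase_sin \<omega> p y \<le> phase_sin \<omega> p x"
    and nz: "\<And>y. y \<in> {-1..1} \<Longrightarrow> twist \<omega> p y \<noteq> 0"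
  shows "poly (phase_speed \<omega> p) (\<i> * of_real x) = 0"
proof -
  define A where "A = (\<lambda>y. Re (twist \<omega> p y))"
  define B where "B = (\<lambda>y. Im (twist \<omega> p y))"
  define Q' where "Q' = \<i> * twist \<omega> (pderiv p + smult (of_real (\<omega> / 2)) p) x"
  have dA: "(A has_real_derivative Re Q') (at x)" and dB: "(B has_real_derivative Im Q') (at x)"
    unfolding A_def B_def Q'_def has_real_derivative_iff_has_vector_derivative
    by (intro bounded_linear.has_vector_derivative [OF bounded_linear_Re]
        bounded_linear.has_vector_derivative [OF bounded_linear_Im] twist_has_vector_derivative)+
  have nrm: "(cmod (twist \<omega> p y))\<^sup>2 = (A y)\<^sup>2 + (B y)\<^sup>2" for y
    by (simp add: A_def B_def cmod_power2)
  have npos: "(A y)\<^sup>2 + (B y)\<^sup>2 > 0" if "y \<in> {-1..1}" for y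
    using nz [OF that] by (simp flip: nrm)
  define q where "q = (\<lambda>y. (B y)\<^sup>2 * (A x)\<^sup>2 - (B x)\<^sup>2 * (A y)\<^sup>2)"
  have q: "q y \<le> q x" if "y \<in> {-1..1}" for y
  proof -
    have "(phase_sin \<omega> p y)\<^sup>2 \<le> (phase_sin \<omega> p x)\<^sup>2"
      using max [OF that] by (intro power_mono) (auto simp: phase_sin_def)
    then have "(B y)\<^sup>2 / ((A y)\<^sup>2 + (B y)\<^sup>2) \<le> (B x)\<^sup>2 / ((A x)\<^sup>2 + (B x)\<^sup>2)"
      by (simp add: phase_sin_def power_divide nrm) (simp add: B_def)
    then have "(B y)\<^sup>2 * ((A x)\<^sup>2 + (B x)\<^sup>2) \<le> (B x)\<^sup>2 * ((A y)\<^sup>2 + (B y)\<^sup>2)"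
      using npos [OF that] npos [of x] x by (simp add: divide_le_eq pos_le_divide_eq mult.commute)
    then show ?thesis by (simp add: q_def algebra_simps)
  qed
  have dq: "(q has_real_derivative 2 * A x * B x * (A x * Im Q' - B x * Re Q')) (at x)"
    unfolding q_def by (rule derivative_eq_intros dA dB refl | simp add: algebra_simps power2_eq_square)+
  have d: "1 - \<bar>x\<bar> > 0" using x by auto
  have inI: "y \<in> {-1..1}" if "\<bar>x - y\<bar> < 1 - \<bar>x\<bar>" for y
    using that by auto
  have "2 * A x * B x * (A x * Im Q' - B x * Re Q') = 0"
    by (rule DERIV_local_max [OF dq d]) (use q inI in blast)
  moreover have "A x \<noteq> 0" using A by (simp add: A_def)
  ultimately have "B x = 0 \<or> A x * Im Q' - B x * Re Q' = 0" by simp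
  moreover have "Im Q' = 0" if "B x = 0"
  proof -
    have "B y = 0" if y: "y \<in> {-1..1}" for y
      using q [OF y] \<open>B x = 0\<close> \<open>A x \<noteq> 0\<close> by (simp add: q_def mult_le_0_iff)
    then have "\<forall>y. \<bar>x - y\<bar> < 1 - \<bar>x\<bar> \<longrightarrow> B y \<le> B x" using inI \<open>B x = 0\<close> by auto
    then show ?thesis by (rule DERIV_local_max [OF dB d])
  qed
  ultimately have "A x * Im Q' - B x * Re Q' = 0" by auto
  then show ?thesis
    unfolding poly_phase_speed by (simp add: A_def B_def Q'_def)
qed

lemma extremal_set_small:
  assumes \<omega>: "\<omega> \<noteq> 0" and A: "\<And>y. y \<in> {-1..1} \<Longrightarrow> Re (twist \<omega> p y) \<noteq> 0"
    and max: "\<And>y. y \<in> {-1..1} \<Longrightarrow> phase_sin \<omega> p y \<le> M"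
  shows "finite {x \<in> {-1..1}. phase_sin \<omega> p x = M}"
    "card {x \<in> {-1..1}. phase_sin \<omega> p x = M} \<le> 2 * degree p + 2"
proof -
  let ?X = "{x \<in> {-1..1}. phase_sin \<omega> p x = M}"
  define Z where "Z = {z. poly (phase_speed \<omega> p) z = 0}"
  have nz: "twist \<omega> p y \<noteq> 0" if "y \<in> {-1..1}" for y
    using A [OF that] by auto
  have "p \<noteq> 0" using nz [of 0] by (auto simp: twist_def)
  then have W: "phase_speed \<omega> p \<noteq> 0"
    using phase_speed_nonzero \<omega> by blast
  then have Z: "finite Z" "card Z \<le> 2 * degree p"
    unfolding Z_def using poly_roots_finite [OF W] card_poly_roots_bound [OF W] degree_phase_speed [of \<omega> p]
    by auto
  have sub: "?X \<subseteq> {-1, 1} \<union> Im ` Z"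
  proof
    fix x assume x: "x \<in> ?X"
    show "x \<in> {-1, 1} \<union> Im ` Z"
    proof (cases "x = -1 \<or> x = 1")
      case False
      then have "poly (phase_speed \<omega> p) (\<i> * of_real x) = 0"
        using x A nz max by (intro interior_extremum_phase_speed) auto
      then have "\<i> * of_real x \<in> Z" by (simp add: Z_def)
      then have "Im (\<i> * of_real x) \<in> Im ` Z" by (rule imageI)
      then show ?thesis by simp
    qed auto
  qed
  have fin: "finite ({-1, 1} \<union> Im ` Z)" using Z by simp
  show "finite ?X" using sub fin by (rule finite_subset)
  have "card ?X \<le> card ({-1, 1} \<union> Im ` Z)" using sub fin by (intro card_mono)
  also have "\<dots> \<le> card {-1, 1::real} + card (Im ` Z)" by (rule card_Un_le)
  also have "\<dots> \<le> 2 + 2 * degree p" using card_image_le [OF Z(1), of Im] Z(2) by simp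
  finally show "card ?X \<le> 2 * degree p + 2" by simp
qed

text \<open>
  It suffices to lower \<open>(Im Q)\<^sup>2 - M\<^sup>2 \<bar>Q\<bar>\<^sup>2\<close> below zero, where \<open>M\<close> is the extremal value of \<open>\<bar>Im Q\<bar> / \<bar>Q\<bar>\<close>. If the
  direction \<open>D\<close> satisfies \<open>Im (D * cnj Q) = - Re Q * Im Q\<close> at the extremal points, the first-order change of this
  expression is negative there. The at most \<open>2 * degree p + 2\<close> conditions are met by interpolation in degree at
  most \<open>2 * degree p + 1\<close>, for which the tangent equation has a solution of degree at most \<open>degree p + 1 \<le> n\<close>.
\<close>
lemma non_maximal_degree_improvable:
  assumes \<omega>: "\<omega> \<noteq> 0" and cop: "coprime p (dag p)" and deg: "degree p < n"
    and A: "\<And>y. y \<in> {-1..1} \<Longrightarrow> Re (twist \<omega> p y) \<noteq> 0"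
  shows "\<exists>u\<in>unitary_rat n. exp_err \<omega> u < exp_err \<omega> (Fraction_Field.Fract (dag p) p)"
proof -
  have nz: "twist \<omega> p y \<noteq> 0" if "y \<in> {-1..1}" for y
    using A [OF that] by auto
  have p: "p \<noteq> 0" using nz [of 0] by (auto simp: twist_def)
  obtain x0 where x0: "x0 \<in> {-1..1}"
    and err: "exp_err \<omega> (Fraction_Field.Fract (dag p) p) = 2 * phase_sin \<omega> p x0"
    and max: "\<And>y. y \<in> {-1..1} \<Longrightarrow> phase_sin \<omega> p y \<le> phase_sin \<omega> p x0"
    using exp_err_attained [of p \<omega>] nz unfolding twist_eq_0_iff by blast
  define M where "M = phase_sin \<omega> p x0"
  define X where "X = {x \<in> {-1..1}. phase_sin \<omega> p x = M}"
  have X: "finite X" "card X \<le> 2 * degree p + 2"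
    unfolding X_def by (rule extremal_set_small; use \<omega> A max in \<open>auto simp: M_def\<close>)+
  \<comment> \<open>Otherwise every point of the interval would be extremal.\<close>
  have M: "M > 0"
  proof (rule ccontr)
    have "phase_sin \<omega> p y \<ge> 0" for y by (simp add: phase_sin_def)
    moreover assume "\<not> M > 0"
    ultimately have "phase_sin \<omega> p y = M" if "y \<in> {-1..1}" for y
      using max [OF that] unfolding M_def by (smt (verit))
    then have "{-1..1} \<subseteq> X" by (auto simp: X_def)
    then have "finite {-1..1::real}" using X(1) finite_subset by blast
    then show False using infinite_Icc [of "-1" "1::real"] by simp
  qed
  let ?Q = "twist \<omega> p"
  obtain H where H: "dag H = - H" "degree H \<le> card X - 1"
    "\<And>x. x \<in> X \<Longrightarrow> poly H (\<i> * of_real x) = 2 * \<i> * of_real (- (Re (?Q x) * Im (?Q x)))"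
    using antisymmetric_interpolation [OF X(1), of "\<lambda>x. - (Re (?Q x) * Im (?Q x))"] by blast
  have "degree H \<le> 2 * degree p + 1" using H(2) X(2) by linarith
  then obtain d where d: "degree d \<le> degree p + 1" "d * dag p - dag d * p = H"
    using solve_tangent_equation [OF cop p H(1)] by blast
  let ?D = "twist \<omega> d"
  have tangent: "Im (?D x * cnj (?Q x)) = - (Re (?Q x) * Im (?Q x))" if "x \<in> X" for x
  proof -
    define e where "e = exp (\<i> * of_real (\<omega> * x / 2))"
    have ce: "e * cnj e = 1"
      by (simp add: e_def complex_norm_square [symmetric])
    define w where "w = poly d (\<i> * of_real x) * cnj (poly p (\<i> * of_real x))"
    have "?D x * cnj (?Q x) = w * (e * cnj e)"
      by (simp add: twist_def e_def w_def)
    then have "?D x * cnj (?Q x) = w" using ce by simp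
    moreover have "w - cnj w = poly H (\<i> * of_real x)"
      unfolding d(2) [symmetric] by (simp add: poly_dag_imag w_def)
    moreover have "Im w = v" if "w - cnj w = 2 * \<i> * of_real v" for v
      using arg_cong [OF that, of Im] by simp
    ultimately show ?thesis using H(3) [OF that] by metis
  qed
  define f where "f = (\<lambda>x. M\<^sup>2 * (cmod (?Q x))\<^sup>2 - (Im (?Q x))\<^sup>2)"
  define g where "g = (\<lambda>x. 2 * (M\<^sup>2 * Re (?D x * cnj (?Q x)) - Im (?Q x) * Im (?D x)))"
  define h where "h = (\<lambda>x. M\<^sup>2 * (cmod (?D x))\<^sup>2 - (Im (?D x))\<^sup>2)"
  have sq: "(phase_sin \<omega> p x)\<^sup>2 * (cmod (?Q x))\<^sup>2 = (Im (?Q x))\<^sup>2" if "x \<in> {-1..1}" for x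
    using nz [OF that] by (simp add: phase_sin_def power_divide)
  have "\<exists>t>0. \<forall>x\<in>{-1..1}. f x + t * g x + t\<^sup>2 * h x > 0"
  proof (rule compact_perturbation_pos)
    show "continuous_on {-1..1} f" "continuous_on {-1..1} g" "continuous_on {-1..1} h"
      unfolding f_def g_def h_def by (intro continuous_intros)+
    fix x :: real assume x: "x \<in> {-1..1}"
    have "(phase_sin \<omega> p x)\<^sup>2 \<le> M\<^sup>2"
      unfolding M_def by (intro power_mono max x) (simp add: phase_sin_def)
    then show "f x \<ge> 0"
      unfolding f_def sq [OF x, symmetric] by (simp add: mult_right_mono)
    assume "f x = 0"
    then have f0: "M\<^sup>2 * (cmod (?Q x))\<^sup>2 = (Im (?Q x))\<^sup>2" by (simp add: f_def)
    then have "(phase_sin \<omega> p x)\<^sup>2 = M\<^sup>2"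
      using nz [OF x] sq [OF x] by (metis mult_cancel_right norm_eq_zero power_eq_0_iff)
    then have "phase_sin \<omega> p x = M"
      by (rule power2_eq_imp_eq [OF _ phase_sin_nonneg less_imp_le [OF M]])
    then have "x \<in> X" using x by (simp add: X_def)
    define a b e k where "a = Re (?Q x)" and "b = Im (?Q x)" and "e = Re (?D x)" and "k = Im (?D x)"
    have t: "k * a - e * b = - (a * b)"
      using tangent [OF \<open>x \<in> X\<close>] by (simp add: a_def b_def e_def k_def)
    have N: "(cmod (?Q x))\<^sup>2 = a\<^sup>2 + b\<^sup>2" by (simp add: cmod_power2 a_def b_def)
    have g: "g x = 2 * (M\<^sup>2 * (e * a + k * b) - b * k)"
      by (simp add: g_def a_def b_def e_def k_def)
    have "a \<noteq> 0" using A [OF x] by (simp add: a_def)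
    then have N0: "a\<^sup>2 + b\<^sup>2 > 0" by (simp add: sum_power2_gt_zero_iff)
    have f0': "M\<^sup>2 * (a\<^sup>2 + b\<^sup>2) = b\<^sup>2" using f0 unfolding N by (simp add: b_def)
    then have "b \<noteq> 0" using M N0 by auto
    have "g x * (a\<^sup>2 + b\<^sup>2) = 2 * (M\<^sup>2 * (a\<^sup>2 + b\<^sup>2) * (e * a + k * b) - b * k * (a\<^sup>2 + b\<^sup>2))"
      unfolding g by (simp add: algebra_simps)
    also have "\<dots> = - 2 * a * b * (k * a - e * b)"
      unfolding f0' by (simp add: algebra_simps power2_eq_square)
    also have "\<dots> = 2 * (a * b)\<^sup>2"
      unfolding t by (simp add: power2_eq_square)
    also have "\<dots> > 0" using \<open>a \<noteq> 0\<close> \<open>b \<noteq> 0\<close> by simp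
    finally show "g x > 0" using N0 by (simp add: zero_less_mult_iff)
  qed simp
  then obtain t where t: "\<And>x. x \<in> {-1..1} \<Longrightarrow> f x + t * g x + t\<^sup>2 * h x > 0" by blast
  define q where "q = p + smult (of_real t) d"
  have tq: "twist \<omega> q x = ?Q x + of_real t * ?D x" for x
    by (simp add: q_def twist_add twist_smult)
  have exp: "M\<^sup>2 * (cmod (twist \<omega> q x))\<^sup>2 - (Im (twist \<omega> q x))\<^sup>2 = f x + t * g x + t\<^sup>2 * h x" for x
    unfolding tq f_def g_def h_def cmod_power2 by (simp add: algebra_simps power2_eq_square)
  have less: "(Im (twist \<omega> q x))\<^sup>2 < M\<^sup>2 * (cmod (twist \<omega> q x))\<^sup>2" if "x \<in> {-1..1}" for x
    using t [OF that] unfolding exp [symmetric] by simp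
  have nzq: "twist \<omega> q x \<noteq> 0" if "x \<in> {-1..1}" for x
    using less [OF that] by auto
  obtain x1 where x1: "x1 \<in> {-1..1}" "exp_err \<omega> (Fraction_Field.Fract (dag q) q) = 2 * phase_sin \<omega> q x1"
    using exp_err_attained [of q \<omega>] nzq unfolding twist_eq_0_iff by blast
  have "\<bar>Im (twist \<omega> q x1)\<bar> < M * cmod (twist \<omega> q x1)"
    using less [OF x1(1)] M
    by - (rule power2_less_imp_less, simp_all add: power_mult_distrib)
  then have "phase_sin \<omega> q x1 < M"
    using nzq [OF x1(1)] by (simp add: phase_sin_def divide_less_eq)
  then have "exp_err \<omega> (Fraction_Field.Fract (dag q) q) < exp_err \<omega> (Fraction_Field.Fract (dag p) p)"
    unfolding x1(2) err M_def by simp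
  moreover have "degree q \<le> n"
    unfolding q_def using d(1) deg by (intro degree_add_le order_trans [OF degree_smult_le]) auto
  moreover have "q \<noteq> 0" using nzq [of 0] by (auto simp: twist_def)
  ultimately show ?thesis by (auto simp: unitary_rat_def)
qed

section \<open>Nonnegative real part at the critical frequency\<close>

text \<open>
  Replacing \<open>p\<close> by \<open>p - p (\<cdot> + h)\<close> lowers the degree and, by Pascal's rule, turns the sum for \<open>Suc N\<close> into the sum
  for \<open>N\<close>.
\<close>
lemma poly_finite_difference:
  fixes p :: "'a::idom poly"
  assumes "p = 0 \<or> degree p < N"
  shows "(\<Sum>j\<le>N. (-1) ^ j * of_nat (N choose j) * poly p (a + of_nat j * h)) = 0"
  using assms
proof (induction N arbitrary: p)
  case 0
  then show ?case by simp
next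
  case (Suc N)
  define q where "q = p - pcompose p [:h, 1:]"
  let ?f = "\<lambda>j. poly p (a + of_nat j * h)"
  have "q = 0 \<or> degree q < N"
  proof (cases "degree p = 0")
    case True
    then obtain c where "p = [:c:]" by (meson degree_eq_zeroE)
    then show ?thesis by (simp add: q_def)
  next
    case False
    have "coeff q (degree p) = 0"
      using lead_coeff_comp [of "[:h, 1:]" p] by (simp add: q_def degree_pcompose)
    moreover have "degree q \<le> degree p"
      unfolding q_def by (intro degree_diff_le) (simp_all add: degree_pcompose)
    ultimately have "degree q < degree p"
      using False by (metis coeff_0_degree_minus_1 diff_less le_less leading_coeff_0_iff degree_0 neq0_conv zero_less_one)
    then show ?thesis using Suc.prems by auto
  qed
  then have IH: "(\<Sum>j\<le>N. (-1) ^ j * of_nat (N choose j) * poly q (a + of_nat j * h)) = 0"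
    by (rule Suc.IH)
  have q: "poly q (a + of_nat j * h) = ?f j - ?f (Suc j)" for j
    by (simp add: q_def poly_pcompose algebra_simps)
  let ?b = "\<lambda>j. (-1) ^ j * of_nat (N choose j) * ?f j"
  have 1: "(\<Sum>j\<le>N. ?b j) = ?f 0 + (\<Sum>j\<le>N. (-1) ^ Suc j * of_nat (N choose Suc j) * ?f (Suc j))"
  proof -
    have "(\<Sum>j\<le>N. ?b j) = (\<Sum>j\<le>Suc N. ?b j)" by (simp add: binomial_eq_0)
    also have "\<dots> = ?b 0 + (\<Sum>j\<le>N. ?b (Suc j))" by (rule sum.atMost_Suc_shift)
    finally show ?thesis by simp
  qed
  have "(\<Sum>j\<le>Suc N. (-1) ^ j * of_nat (Suc N choose j) * ?f j)
      = ?f 0 + (\<Sum>j\<le>N. (-1) ^ Suc j * of_nat (Suc N choose Suc j) * ?f (Suc j))"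
    by (subst sum.atMost_Suc_shift) simp
  also have "\<dots> = ?f 0 + (\<Sum>j\<le>N. (-1) ^ Suc j * of_nat (N choose Suc j) * ?f (Suc j))
      - (\<Sum>j\<le>N. (-1) ^ j * of_nat (N choose j) * ?f (Suc j))"
    by (simp add: algebra_simps sum.distrib sum_subtractf sum_negf)
  also have "\<dots> = (\<Sum>j\<le>N. ?b j) - (\<Sum>j\<le>N. (-1) ^ j * of_nat (N choose j) * ?f (Suc j))"
    unfolding 1 ..
  also have "\<dots> = 0"
    using IH unfolding q by (simp add: algebra_simps sum_subtractf)
  finally show ?case .
qed

text \<open>
  Here all \<open>n + 2\<close> nodes lie in \<open>[-1, 1]\<close>. The finite difference makes \<open>Re (twist \<omega> p)\<close> vanish at each of them.
  For \<open>s = (- \<i>) ^ (n + 1) * p\<close> this means that \<open>s + dag s\<close>, of degree at most \<open>n\<close>, has \<open>n + 2\<close> zeros; so \<open>s\<close> is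
  purely imaginary on the axis, say \<open>s (\<i> x) = \<i> b x\<close>, and \<open>Re (twist \<omega> p x) = - b x * sin (\<pi> t)\<close>. The sine changes
  sign at the \<open>n\<close> inner nodes, so \<open>b\<close> has to vanish there, which determines \<open>p\<close> up to a factor \<open>c\<close>.
\<close>
lemma Re_twist_nonneg_imp_comb:
  assumes \<omega>: "\<omega> = (real n + 1) * pi" and deg: "degree p \<le> n" and p: "p \<noteq> 0"
    and nonneg: "\<And>x. x \<in> {-1..1} \<Longrightarrow> Re (twist \<omega> p x) \<ge> 0"
  shows "\<exists>\<mu>>0. p = smult (of_real \<mu>) (comb n \<omega>)"
proof -
  have \<omega>0: "\<omega> > 0" using \<omega> by simp
  define y where "y = node n \<omega>"
  have y: "y j = -1 + real j * (2 / (real n + 1))" for j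
  proof -
    have "y j = (2 * real j - (real n + 1)) / (real n + 1)"
      unfolding y_def node_def \<omega> by simp
    then show ?thesis by (simp add: diff_divide_distrib)
  qed
  have yI: "y j \<in> {-1..1}" if "j \<le> n + 1" for j
    using that unfolding y by (auto simp: field_simps)
  have tw: "twist \<omega> p (y j) = (- \<i>) ^ (n + 1) * ((-1) ^ j * poly p (\<i> * of_real (y j)))" for j
    unfolding twist_def y_def exp_at_node [OF \<omega>0] by (simp only: mult_ac)
  have "(\<Sum>j\<le>n + 1. of_nat (n + 1 choose j) * twist \<omega> p (y j)) = (- \<i>) ^ (n + 1) *
      (\<Sum>j\<le>n + 1. (-1) ^ j * of_nat (n + 1 choose j) * poly p (- \<i> + of_nat j * (\<i> * of_real (2 / (real n + 1)))))"
  proof -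
    have pt: "\<i> * of_real (y j) = - \<i> + of_nat j * (\<i> * of_real (2 / (real n + 1)))" for j
      unfolding y by (simp add: algebra_simps)
    show ?thesis
      unfolding tw sum_distrib_left pt by (intro sum.cong refl) (simp only: mult_ac)
  qed
  also have "\<dots> = 0"
    by (subst poly_finite_difference) (use deg in simp_all)
  finally have "Re (\<Sum>j\<le>n + 1. of_nat (n + 1 choose j) * twist \<omega> p (y j)) = 0" by simp
  then have "(\<Sum>j\<le>n + 1. real (n + 1 choose j) * Re (twist \<omega> p (y j))) = 0"
    by simp
  then have "real (n + 1 choose j) * Re (twist \<omega> p (y j)) = 0" if "j \<le> n + 1" for j
    using sum_nonneg_eq_0_iff [of "{..n + 1}" "\<lambda>j. real (n + 1 choose j) * Re (twist \<omega> p (y j))"]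
      nonneg yI that by auto
  then have Re0: "Re (twist \<omega> p (y j)) = 0" if "j \<le> n + 1" for j
    using that by (auto simp: binomial_eq_0_iff simp del: binomial_Suc_Suc)
  define s where "s = smult ((- \<i>) ^ (n + 1)) p"
  have "inj y" unfolding y by (intro injI) simp
  then have inj: "inj_on (\<lambda>j. \<i> * complex_of_real (y j)) A" for A
    by (auto intro!: inj_onI dest: injD)
  have "s + dag s = 0"
  proof (rule poly_eqI_degree [where A = "(\<lambda>j. \<i> * complex_of_real (y j)) ` {..n + 1}"])
    let ?A = "(\<lambda>j. \<i> * complex_of_real (y j)) ` {..n + 1}"
    have cA: "card ?A = n + 2" using card_image [OF inj, of "{..n + 1}"] by simp
    have "degree (s + dag s) \<le> n"
      using deg by (intro degree_add_le) (auto simp: s_def)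
    then show "degree (s + dag s) < card ?A" "degree (0::complex poly) < card ?A"
      unfolding cA by simp_all
    fix z assume "z \<in> ?A"
    then obtain j where j: "j \<le> n + 1" "z = \<i> * of_real (y j)" by auto
    have "Re (poly s z) = (-1) ^ j * Re (twist \<omega> p (y j))"
      unfolding tw s_def j(2) by (cases "even j") simp_all
    then have "Re (poly s z) = 0" using Re0 [OF j(1)] by simp
    then show "poly (s + dag s) z = poly 0 z"
      unfolding j(2) poly_add poly_dag_imag by (simp add: complex_eq_iff)
  qed
  then have s_imag: "Re (poly s (\<i> * of_real x)) = 0" for x
  proof -
    have "poly (s + dag s) (\<i> * of_real x) = 0" using \<open>s + dag s = 0\<close> by simp
    then show ?thesis unfolding poly_add poly_dag_imag by (simp add: complex_eq_iff)
  qed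
  define b where "b = (\<lambda>x. Im (poly s (\<i> * of_real x)))"
  define t where "t = (\<lambda>x. (\<omega> * x / pi + (real n + 1)) / 2)"
  have tws: "twist \<omega> p x = poly s (\<i> * of_real x) * cis (pi * t x)" for x
  proof -
    have "exp (\<i> * of_real (\<omega> * x / 2)) = exp (\<i> * of_real (pi * t x)) * (- \<i>) ^ (n + 1)"
      by (rule exp_quarter_turns) (simp add: t_def add_divide_distrib)
    then show ?thesis unfolding twist_def s_def cis_conv_exp by simp
  qed
  have Re_tw: "Re (twist \<omega> p x) = - b x * sin (pi * t x)" for x
    unfolding tws b_def by (simp add: s_imag)
  have root: "poly p (\<i> * of_real (y j)) = 0" if j: "j \<in> {1..n}" for j
  proof -
    define \<beta> where "\<beta> = (\<lambda>x. (-1) ^ j * b x)"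
    define h where "h = 2 / (real n + 1)"
    have h: "h > 0" by (simp add: h_def)
    have \<omega>h: "\<omega> / 2 * h = pi" by (simp add: h_def \<omega>)
    have "y (j - 1) = y j - h" "y (j + 1) = y j + h"
      using j unfolding y h_def by (simp_all add: of_nat_diff left_diff_distrib distrib_right add_divide_distrib diff_divide_distrib)
    then have I: "y j - h \<ge> -1" "y j + h \<le> 1"
      using yI [of "j - 1"] yI [of "j + 1"] j by auto
    have sin: "sin (pi * t x) = (-1) ^ j * sin (\<omega> / 2 * (x - y j))" for x
    proof -
      have "x - y j = - (2 * pi / \<omega> * (real j - t x))"
        unfolding t_def y_def node_diff [OF \<omega>0, symmetric] by simp
      then have "pi * t x = \<omega> / 2 * (x - y j) + pi * real j"
        using \<omega>0 by (simp add: right_diff_distrib)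
      then show ?thesis by (simp add: sin_add mult.commute)
    qed
    have A: "- (\<beta> x * sin (\<omega> / 2 * (x - y j))) \<ge> 0" if "x \<in> {-1..1}" for x
      using nonneg [OF that] unfolding Re_tw sin \<beta>_def by (simp add: mult_ac)
    have right: "\<beta> x \<le> 0" if x: "x \<in> {y j<..<y j + h}" for x
    proof -
      have "\<omega> / 2 * (x - y j) < \<omega> / 2 * h" "\<omega> / 2 * (x - y j) > 0"
        using x \<omega>0 by (auto intro!: mult_strict_left_mono)
      then have "sin (\<omega> / 2 * (x - y j)) > 0" unfolding \<omega>h by (intro sin_gt_zero) auto
      then show ?thesis using A [of x] I x by (auto simp: mult_le_0_iff)
    qed
    have left: "\<beta> x \<ge> 0" if x: "x \<in> {y j - h<..<y j}" for x
    proof -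
      have "\<omega> / 2 * (y j - x) < \<omega> / 2 * h" "\<omega> / 2 * (y j - x) > 0"
        using x \<omega>0 by (auto intro!: mult_strict_left_mono)
      then have "sin (\<omega> / 2 * (y j - x)) > 0" unfolding \<omega>h by (intro sin_gt_zero) auto
      moreover have "sin (\<omega> / 2 * (x - y j)) = - sin (\<omega> / 2 * (y j - x))"
        using sin_minus [of "\<omega> / 2 * (y j - x)"]
        by (metis minus_diff_eq mult_minus_right)
      ultimately show ?thesis using A [of x] I x by (auto simp: zero_le_mult_iff)
    qed
    have "continuous_on UNIV \<beta>"
      unfolding \<beta>_def b_def by (intro continuous_intros)
    then have cont: "(\<beta> \<longlongrightarrow> \<beta> (y j)) (at (y j) within S)" for S
      by (meson UNIV_I continuous_on_def continuous_on_subset subset_UNIV tendsto_within_subset)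
    have "\<beta> (y j) \<le> 0"
      by (rule tendsto_upperbound [OF cont [of "{y j<..}"]])
         (use right h in \<open>auto intro!: eventually_mono [OF eventually_at_right_real [of "y j" "y j + h"]]\<close>)
    moreover have "\<beta> (y j) \<ge> 0"
      by (rule tendsto_lowerbound [OF cont [of "{..<y j}"]])
         (use left h in \<open>auto intro!: eventually_mono [OF eventually_at_left_real [of "y j - h" "y j"]]\<close>)
    ultimately have "b (y j) = 0" by (simp add: \<beta>_def)
    then have "poly s (\<i> * of_real (y j)) = 0"
      using s_imag [of "y j"] by (simp add: b_def complex_eq_iff)
    then show ?thesis by (simp add: s_def)
  qed
  have lc: "coeff (comb n \<omega>) n \<noteq> 0"
    using leading_coeff_0_iff [of "comb n \<omega>"] by (simp del: leading_coeff_0_iff)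
  define c where "c = coeff p n / coeff (comb n \<omega>) n"
  have pc: "p = smult c (comb n \<omega>)"
  proof (rule poly_eqI_degree_lead_coeff [where n = n and A = "(\<lambda>j. \<i> * complex_of_real (y j)) ` {1..n}"])
    let ?A = "(\<lambda>j. \<i> * complex_of_real (y j)) ` {1..n}"
    show "degree p \<le> n" "degree (smult c (comb n \<omega>)) \<le> n"
      "coeff p n = coeff (smult c (comb n \<omega>)) n"
      using deg lc by (auto simp: c_def)
    show "n \<le> card ?A" using card_image [OF inj, of "{1..n}"] by simp
    fix z assume "z \<in> ?A"
    then obtain j where j: "j \<in> {1..n}" "z = \<i> * of_real (y j)" by auto
    have "poly (comb n \<omega>) z = 0"
      unfolding comb_def poly_prod j(2) y_def using j(1) by (intro prod_zero bexI [of _ j]) auto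
    then show "poly p z = poly (smult c (comb n \<omega>)) z"
      using root [OF j(1)] j(2) by simp
  qed
  \<comment> \<open>At the midpoint of the first two nodes \<open>t = 1/2\<close>, and the twisted values of \<open>comb n \<omega>\<close> are real and
     positive; so the sign of \<open>c\<close> can be read off.\<close>
  define x where "x = - real n / (real n + 1)"
  have x: "x \<in> {-1..1}" by (simp add: x_def field_simps)
  have tx: "t x = 1 / 2"
  proof -
    have "\<omega> * x / pi = (real n + 1) * (- real n / (real n + 1))"
      by (simp only: x_def \<omega>) simp
    then show ?thesis by (simp add: t_def)
  qed
  define K where "K = (2 * pi / \<omega>) ^ n * (\<Prod>j=1..n. real j - 1 / 2)"
  have K: "K > 0"
    unfolding K_def using \<omega>0 by (intro mult_pos_pos prod_pos zero_less_power) auto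
  have "twist \<omega> (comb n \<omega>) x = of_real K"
  proof -
    have "(\<omega> * x / pi + (real n + 1)) / 2 = 1 / 2"
      using tx by (simp only: t_def)
    moreover have "exp (\<i> * of_real (pi * (1 / 2))) = \<i>"
      unfolding cis_conv_exp [symmetric] by simp
    moreover have "- \<i> * w * \<i> = w" for w
      by (simp add: complex_eq_iff)
    ultimately show ?thesis
      unfolding twist_comb [OF \<omega>0] K_def by (simp only:)
  qed
  then have twx: "twist \<omega> p x = c * of_real K"
    by (subst pc) (simp add: twist_smult)
  have "poly s (\<i> * of_real x) * \<i> = c * of_real K"
    using tws [of x] unfolding twx tx by simp
  from arg_cong [OF this, of Im] have "Im c = 0"
    using s_imag [of x] K by simp
  moreover have "Re c \<ge> 0"
    using nonneg [OF x] K unfolding twx by (simp add: zero_le_mult_iff)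
  moreover have "c \<noteq> 0" using p pc by auto
  ultimately have "Re c > 0" "c = of_real (Re c)"
    by (auto simp: complex_eq_iff less_le)
  then show ?thesis using pc by metis
qed

section \<open>Convergence of the roots\<close>

lemma poly_eq_sum_atMost:
  fixes p :: "'a::comm_semiring_1 poly"
  assumes "degree p \<le> n"
  shows "poly p x = (\<Sum>i\<le>n. coeff p i * x ^ i)"
  unfolding poly_altdef using assms
  by (intro sum.mono_neutral_left) (auto simp: coeff_eq_0)

lemma tendsto_poly_coeffwise:
  fixes q :: "nat \<Rightarrow> 'a::{real_normed_algebra_1,comm_ring_1} poly"
  assumes "\<And>k. degree (q k) \<le> n" "degree p \<le> n"
    and "\<And>i. (\<lambda>k. coeff (q k) i) \<longlonglongrightarrow> coeff p i" "z \<longlonglongrightarrow> w"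
  shows "(\<lambda>k. poly (q k) (z k)) \<longlonglongrightarrow> poly p w"
  unfolding poly_eq_sum_atMost [OF assms(1)] poly_eq_sum_atMost [OF assms(2)]
  by (intro tendsto_intros assms)

text \<open>
  The sum of the moduli of the coefficients is scaled to one, which the limit inherits and which keeps it
  from being zero. Compactness is that of a product of discs.
\<close>
lemma normalized_convergent_subsequence:
  fixes p :: "nat \<Rightarrow> complex poly"
  assumes deg: "\<And>k. degree (p k) \<le> n" and nz: "\<And>k. p k \<noteq> 0"
  obtains \<phi> :: "nat \<Rightarrow> nat" and a :: "nat \<Rightarrow> real" and P :: "complex poly"
  where "strict_mono \<phi>" "\<And>k. a k > 0" "P \<noteq> 0" "degree P \<le> n"
    "\<And>i. (\<lambda>k. coeff (smult (of_real (a k)) (p (\<phi> k))) i) \<longlonglongrightarrow> coeff P i"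
proof -
  define N where "N = (\<lambda>k. \<Sum>i\<le>n. cmod (coeff (p k) i))"
  have le: "cmod (coeff (p k) i) \<le> N k" for k i
  proof (cases "i \<le> n")
    case True
    then show ?thesis unfolding N_def by (intro member_le_sum) auto
  next
    case False
    then show ?thesis using deg [of k] unfolding N_def by (simp add: coeff_eq_0 sum_nonneg)
  qed
  have N: "N k > 0" for k
    using le [of k "degree (p k)"] nz [of k]
    by (smt (verit) leading_coeff_0_iff zero_less_norm_iff)
  define c where "c = (\<lambda>k i. coeff (smult (of_real (inverse (N k))) (p k)) i)"
  have cb: "cmod (c k i) \<le> 1" for k i
    using le [of k i] N [of k] by (simp add: c_def norm_mult norm_inverse norm_divide field_simps)
  have "compact (PiE UNIV (\<lambda>_::nat. cball (0::complex) 1))"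
  proof -
    have "compactin (product_topology (\<lambda>_. euclidean) UNIV) (PiE UNIV (\<lambda>_::nat. cball (0::complex) 1))"
      by (simp add: compactin_PiE)
    then show ?thesis
      by (simp add: euclidean_product_topology)
  qed
  then have "seq_compact (PiE UNIV (\<lambda>_::nat. cball (0::complex) 1))"
    by (rule compact_imp_seq_compact)
  moreover have "c k \<in> PiE UNIV (\<lambda>_::nat. cball (0::complex) 1)" for k
    using cb by auto
  ultimately obtain l \<phi> where l: "strict_mono \<phi>" "(c \<circ> \<phi>) \<longlonglongrightarrow> l"
    unfolding seq_compact_def by blast
  have lim: "(\<lambda>k. c (\<phi> k) i) \<longlonglongrightarrow> l i" for i
  proof -
    have "continuous_on UNIV (\<lambda>f::nat \<Rightarrow> complex. f i)"
      by (rule continuous_on_product_coordinates)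
    then have "isCont (\<lambda>f. f i) l"
      by (metis UNIV_I continuous_on_eq_continuous_at open_UNIV)
    from isCont_tendsto_compose [OF this l(2)] show ?thesis by (simp add: o_def)
  qed
  define P where "P = (\<Sum>i\<le>n. monom (l i) i)"
  have cP: "coeff P i = (if i \<le> n then l i else 0)" for i
    by (simp add: P_def coeff_sum)
  have coP: "coeff P i = l i" for i
  proof (cases "i \<le> n")
    case False
    then have "c k i = 0" for k using deg [of k] by (simp add: c_def coeff_eq_0)
    then have "l i = 0" using LIMSEQ_unique [OF lim [of i], of 0] by simp
    then show ?thesis using False by (simp add: cP)
  qed (simp add: cP)
  have "(\<lambda>k. \<Sum>i\<le>n. cmod (c (\<phi> k) i)) \<longlonglongrightarrow> (\<Sum>i\<le>n. cmod (l i))"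
    by (intro tendsto_intros lim)
  moreover have "(\<Sum>i\<le>n. cmod (c k i)) = 1" for k
  proof -
    have "(\<Sum>i\<le>n. cmod (c k i)) = inverse (N k) * N k"
    proof -
      have "cmod (c k i) = inverse (N k) * cmod (coeff (p k) i)" for i
        using N [of k] by (simp add: c_def norm_mult norm_inverse norm_divide divide_inverse_commute)
      then show ?thesis by (simp only: sum_distrib_left [symmetric] N_def)
    qed
    then show ?thesis using N [of k] by simp
  qed
  ultimately have "(\<Sum>i\<le>n. cmod (l i)) = 1"
    by (simp add: LIMSEQ_const_iff)
  then have "P \<noteq> 0"
    using coP by auto
  show ?thesis
  proof (rule that [of \<phi> "\<lambda>k. inverse (N (\<phi> k))" P])
    show "degree P \<le> n" by (intro degree_le) (simp add: cP)
    show "(\<lambda>k. coeff (smult (of_real (inverse (N (\<phi> k)))) (p (\<phi> k))) i) \<longlonglongrightarrow> coeff P i" for i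
      using lim [of i] by (simp add: coP c_def)
  qed (use l N \<open>P \<noteq> 0\<close> in auto)
qed

text \<open>
  The modulus of \<open>q z\<close> is that of the leading coefficient times the product of the distances of \<open>z\<close> to the roots, and a
  nearest root realises the smallest of these.
\<close>
lemma root_near_small_value:
  fixes q :: "complex poly"
  assumes "degree q > 0"
  shows "\<exists>r. poly q r = 0 \<and> cmod (lead_coeff q) * cmod (z - r) ^ degree q \<le> cmod (poly q z)"
proof -
  let ?n = "degree q"
  obtain root where q: "smult (lead_coeff q) (\<Prod>i<?n. [:- root i, 1:]) = q"
    using complex_poly_decompose' by blast
  have pq: "poly q x = lead_coeff q * (\<Prod>i<?n. x - root i)" for x
    by (subst q [symmetric]) (simp add: poly_prod)
  define i where "i = arg_min_on (\<lambda>i. cmod (z - root i)) {..<?n}"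
  have "{..<?n} \<noteq> {}" using assms by (simp add: lessThan_empty_iff)
  from arg_min_if_finite [OF _ this, of "\<lambda>i. cmod (z - root i)"]
  have i: "i < ?n" "\<And>k. k < ?n \<Longrightarrow> cmod (z - root i) \<le> cmod (z - root k)"
    unfolding i_def [symmetric] by (auto simp: not_less)
  have "(\<Prod>k<?n. cmod (z - root i)) \<le> (\<Prod>k<?n. cmod (z - root k))"
    using i by (intro prod_mono) auto
  then have "cmod (lead_coeff q) * cmod (z - root i) ^ ?n \<le> cmod (poly q z)"
    unfolding pq norm_mult by (intro mult_left_mono) (auto simp: prod_norm)
  moreover have "poly q (root i) = 0"
    unfolding pq using i(1) by (auto intro!: prod_zero)
  ultimately show ?thesis by blast
qed

text \<open>
  Each \<open>z j\<close> attracts a root of \<open>q k\<close> because \<open>q k (z j)\<close> tends to zero. As the \<open>z j\<close> are distinct, the \<open>n\<close> roots found in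
  this way are eventually distinct, and hence they are all the roots.
\<close>
lemma simple_roots_converge:
  fixes q :: "nat \<Rightarrow> complex poly"
  assumes n: "n \<ge> 1" and deg: "\<And>k. degree (q k) \<le> n" "degree P = n"
    and lim: "\<And>i. (\<lambda>k. coeff (q k) i) \<longlonglongrightarrow> coeff P i"
    and root: "\<And>j. j \<in> {1..n} \<Longrightarrow> poly P (z j) = 0" and inj: "inj_on z {1..n}"
  obtains f :: "nat \<Rightarrow> nat \<Rightarrow> complex" where
    "\<And>j. j \<in> {1..n} \<Longrightarrow> (\<lambda>k. f k j) \<longlonglongrightarrow> z j"
    "eventually (\<lambda>k. q k = smult (coeff (q k) n) (\<Prod>j=1..n. [:- f k j, 1:])) sequentially"
proof -
  have P0: "P \<noteq> 0" using deg(2) n by auto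
  then have lc: "coeff P n \<noteq> 0" using deg(2) leading_coeff_0_iff [of P] by simp
  have evn: "eventually (\<lambda>k. coeff (q k) n \<noteq> 0) sequentially"
    using tendsto_imp_eventually_ne [OF lim lc] .
  have ex: "\<exists>r. coeff (q k) n \<noteq> 0 \<longrightarrow> poly (q k) r = 0 \<and>
      cmod (coeff (q k) n) * cmod (z j - r) ^ n \<le> cmod (poly (q k) (z j))" for k j
  proof (cases "coeff (q k) n = 0")
    case False
    then have "degree (q k) = n" using deg(1) [of k] by (intro antisym le_degree)
    then show ?thesis using root_near_small_value [of "q k" "z j"] n by auto
  qed auto
  define f where "f = (\<lambda>k j. SOME r. coeff (q k) n \<noteq> 0 \<longrightarrow> poly (q k) r = 0 \<and>
      cmod (coeff (q k) n) * cmod (z j - r) ^ n \<le> cmod (poly (q k) (z j)))"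
  have f: "poly (q k) (f k j) = 0"
      "cmod (coeff (q k) n) * cmod (z j - f k j) ^ n \<le> cmod (poly (q k) (z j))"
    if "coeff (q k) n \<noteq> 0" for k j
    using someI_ex [OF ex [of k j]] that unfolding f_def by blast+
  have flim: "(\<lambda>k. f k j) \<longlonglongrightarrow> z j" if j: "j \<in> {1..n}" for j
  proof -
    have "(\<lambda>k. poly (q k) (z j)) \<longlonglongrightarrow> poly P (z j)"
      using deg lim by (intro tendsto_poly_coeffwise [where n = n]) auto
    then have "(\<lambda>k. cmod (poly (q k) (z j)) / cmod (coeff (q k) n)) \<longlonglongrightarrow> cmod 0 / cmod (coeff P n)"
      unfolding root [OF j] using lc by (intro tendsto_intros lim) auto
    then have 0: "(\<lambda>k. cmod (poly (q k) (z j)) / cmod (coeff (q k) n)) \<longlonglongrightarrow> 0" by simp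
    have "eventually (\<lambda>k. cmod (z j - f k j) ^ n \<le> cmod (poly (q k) (z j)) / cmod (coeff (q k) n)) sequentially"
      using evn
    proof eventually_elim
      case (elim k)
      then show ?case using f(2) [OF elim, of j] by (simp add: pos_le_divide_eq mult.commute)
    qed
    then have "(\<lambda>k. cmod (z j - f k j) ^ n) \<longlonglongrightarrow> 0"
      by (intro tendsto_sandwich [OF _ _ tendsto_const 0]) auto
    then have "(\<lambda>k. root n (cmod (z j - f k j) ^ n)) \<longlonglongrightarrow> root n 0"
      by (rule tendsto_real_root)
    then have "(\<lambda>k. cmod (z j - f k j)) \<longlonglongrightarrow> 0"
      using n by (simp add: real_root_power_cancel)
    then have "(\<lambda>k. z j - f k j) \<longlonglongrightarrow> 0"
      by (simp add: tendsto_norm_zero_iff)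
    from tendsto_diff [OF tendsto_const [of "z j"] this] show ?thesis by simp
  qed
  \<comment> \<open>The limits being distinct, so are the roots from some index on.\<close>
  have "eventually (\<lambda>k. f k i \<noteq> f k j) sequentially" if "i \<in> {1..n}" "j \<in> {1..n}" "i \<noteq> j" for i j
  proof -
    have "z i - z j \<noteq> 0" using inj that by (auto dest: inj_onD)
    then have "eventually (\<lambda>k. f k i - f k j \<noteq> 0) sequentially"
      by (intro tendsto_imp_eventually_ne [OF tendsto_diff [OF flim [OF that(1)] flim [OF that(2)]]])
    then show ?thesis by (rule eventually_mono) auto
  qed
  then have "eventually (\<lambda>k. \<forall>i\<in>{1..n}. \<forall>j\<in>{1..n}. i \<noteq> j \<longrightarrow> f k i \<noteq> f k j) sequentially"
    by (intro eventually_ball_finite ballI) (auto simp: eventually_conj_iff intro: eventually_mono)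
  then have "eventually (\<lambda>k. q k = smult (coeff (q k) n) (\<Prod>j=1..n. [:- f k j, 1:])) sequentially"
    using evn
  proof eventually_elim
    case (elim k)
    let ?R = "\<Prod>j=1..n. [:- f k j, 1:]"
    have injf: "inj_on (f k) {1..n}" using elim(1) by (auto simp: inj_on_def)
    have dR: "degree ?R = n" by (simp add: degree_prod_eq_sum_degree)
    have "coeff ?R n = 1"
      using lead_coeff_prod [of "\<lambda>j. [:- f k j, 1:]" "{1..n}"] unfolding dR by simp
    show ?case
    proof (rule poly_eqI_degree_lead_coeff)
      show "coeff (q k) n = coeff (smult (coeff (q k) n) ?R) n"
        using \<open>coeff ?R n = 1\<close> by simp
      show "n \<le> card (f k ` {1..n})" using card_image [OF injf] by simp
      show "degree (smult (coeff (q k) n) ?R) \<le> n" using dR by simp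
      fix w assume "w \<in> f k ` {1..n}"
      then have "poly ?R w = 0" "poly (q k) w = 0"
        using f(1) [OF elim(2)] unfolding poly_prod by (auto intro!: prod_zero)
      then show "poly (q k) w = poly (smult (coeff (q k) n) ?R) w" by simp
    qed (rule deg)
  qed
  then show ?thesis using flim that by blast
qed

text \<open>
  For the sign of the real part of a root \<open>f k j\<close>, evaluate the twist at the real point \<open>\<beta> = Im (f k j)\<close>. The factor of
  that root is \<open>f k j - \<i> \<beta> = Re (f k j)\<close>, and the product \<open>w\<close> of all other factors tends to the positive number
  of \<open>node_factor_positive\<close>, up to a positive constant. So \<open>Re (f k j) * Re w > 0\<close>
  with \<open>Re w > 0\<close>.
\<close>
lemma positive_twist_roots_converge:
  fixes p :: "nat \<Rightarrow> complex poly"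
  assumes n: "n \<ge> 1" and \<Omega>: "\<Omega> = (real n + 1) * pi" and \<omega>: "\<omega> \<longlonglongrightarrow> \<Omega>"
    and deg: "\<And>k. degree (p k) \<le> n"
    and pos: "\<And>k x. x \<in> {-1..1} \<Longrightarrow> Re (twist (\<omega> k) (p k) x) > 0"
  obtains \<phi> :: "nat \<Rightarrow> nat" and f :: "nat \<Rightarrow> nat \<Rightarrow> complex" where "strict_mono \<phi>"
    "\<And>j. j \<in> {1..n} \<Longrightarrow> (\<lambda>k. f k j) \<longlonglongrightarrow> \<i> * of_real (node n \<Omega> j)"
    "eventually (\<lambda>k. proots (p (\<phi> k)) = image_mset (f k) (mset_set {1..n})
       \<and> (\<forall>j\<in>{1..n}. Re (f k j) > 0)) sequentially"
proof -
  have \<Omega>0: "\<Omega> > 0" using \<Omega> by simp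
  have p0: "p k \<noteq> 0" for k
    using pos [of 0 k] by (auto simp: twist_def)
  obtain \<phi> a P where \<phi>: "strict_mono \<phi>" and a: "\<And>k. a k > 0" and P: "P \<noteq> 0" "degree P \<le> n"
    and lim: "\<And>i. (\<lambda>k. coeff (smult (of_real (a k)) (p (\<phi> k))) i) \<longlonglongrightarrow> coeff P i"
    using normalized_convergent_subsequence [of p n, OF deg p0] by blast
  define q where "q = (\<lambda>k. smult (of_real (a k)) (p (\<phi> k)))"
  define v where "v = (\<lambda>k. \<omega> (\<phi> k))"
  have v: "v \<longlonglongrightarrow> \<Omega>"
    using LIMSEQ_subseq_LIMSEQ [OF \<omega> \<phi>] by (simp add: v_def o_def)
  have degq: "degree (q k) \<le> n" for k
    using deg [of "\<phi> k"] by (simp add: q_def)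
  have limq: "(\<lambda>k. coeff (q k) i) \<longlonglongrightarrow> coeff P i" for i
    using lim unfolding q_def .
  have posq: "Re (twist (v k) (q k) x) > 0" if "x \<in> {-1..1}" for k x
    using pos [OF that, of "\<phi> k"] a [of k] by (simp add: q_def v_def twist_smult)
  have "Re (twist \<Omega> P x) \<ge> 0" if x: "x \<in> {-1..1}" for x
  proof (rule LIMSEQ_le_const)
    show "(\<lambda>k. Re (twist (v k) (q k) x)) \<longlonglongrightarrow> Re (twist \<Omega> P x)"
      unfolding twist_def by (intro tendsto_intros tendsto_poly_coeffwise [OF degq P(2) limq] v) auto
    show "\<exists>N. \<forall>k\<ge>N. 0 \<le> Re (twist (v k) (q k) x)"
      using posq [OF x] less_imp_le by blast
  qed
  then obtain \<mu> where \<mu>: "\<mu> > 0" "P = smult (of_real \<mu>) (comb n \<Omega>)"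
    using Re_twist_nonneg_imp_comb [OF \<Omega> P(2,1)] by blast
  define z where "z = (\<lambda>j. \<i> * complex_of_real (node n \<Omega> j))"
  have node: "node n \<Omega> j = (2 * real j - (real n + 1)) / (real n + 1)" for j
    by (simp add: node_def \<Omega>)
  have injz: "inj_on z {1..n}"
  proof (rule inj_onI)
    fix i j assume "z i = z j"
    then have "node n \<Omega> i = node n \<Omega> j" by (simp add: z_def)
    then show "i = j" unfolding node by (simp add: add_eq_0_iff)
  qed
  have rootz: "poly P (z j) = 0" if "j \<in> {1..n}" for j
    unfolding \<mu>(2) z_def comb_def poly_smult poly_prod using that
    by (intro mult_eq_0_iff [THEN iffD2] disjI2 prod_zero bexI [of _ j]) auto
  have "degree P = n" using \<mu> by simp
  obtain f where f: "\<And>j. j \<in> {1..n} \<Longrightarrow> (\<lambda>k. f k j) \<longlonglongrightarrow> z j"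
    and qf: "eventually (\<lambda>k. q k = smult (coeff (q k) n) (\<Prod>j=1..n. [:- f k j, 1:])) sequentially"
    using simple_roots_converge [OF n degq \<open>degree P = n\<close> limq rootz injz] by blast
  have proots: "proots (p (\<phi> k)) = image_mset (f k) (mset_set {1..n})"
    if k: "q k = smult (coeff (q k) n) (\<Prod>j=1..n. [:- f k j, 1:])" for k
  proof -
    have "q k \<noteq> 0" using a [of k] p0 by (simp add: q_def)
    then have c: "coeff (q k) n \<noteq> 0" using k by auto
    have "proots (p (\<phi> k)) = proots (q k)"
      using a [of k] unfolding q_def by (subst proots_smult) auto
    also have "\<dots> = proots (\<Prod>j=1..n. [:- f k j, 1:])"
      by (subst k) (rule proots_smult [OF c])
    also have "\<dots> = (\<Sum>j=1..n. {#f k j#})"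
      by (subst proots_prod) auto
    also have "\<dots> = image_mset (f k) (mset_set {1..n})"
      by (induction n) (auto simp: atLeastAtMostSuc_conv)
    finally show ?thesis .
  qed
  have Re: "eventually (\<lambda>k. Re (f k j) > 0) sequentially" if j: "j \<in> {1..n}" for j
  proof -
    define \<beta> where "\<beta> = (\<lambda>k. Im (f k j))"
    have \<beta>: "\<beta> \<longlonglongrightarrow> node n \<Omega> j"
      using tendsto_Im [OF f [OF j]] by (simp add: \<beta>_def z_def)
    have nI: "-1 < node n \<Omega> j" "node n \<Omega> j < 1"
      using j by (auto simp: node field_simps)
    define w where "w = (\<lambda>k. (-1) ^ n * coeff (q k) n * (\<Prod>i\<in>{1..n}-{j}. f k i - \<i> * of_real (\<beta> k))
        * exp (\<i> * of_real (v k * \<beta> k / 2)))"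
    obtain c where c: "c > 0" "(\<Prod>i\<in>{1..n}-{j}. z i - z j) * exp (\<i> * of_real (\<Omega> * node n \<Omega> j / 2)) = of_real c"
      using node_factor_positive [OF \<Omega>0 j] unfolding z_def by blast
    have "coeff P n = of_real \<mu> * (-1) ^ n"
    proof -
      have "lead_coeff (comb n \<Omega>) = (-1) ^ n"
        unfolding comb_def by (subst lead_coeff_prod) simp
      then show ?thesis using \<mu> by simp
    qed
    then have lead: "(-1) ^ n * coeff P n = of_real \<mu>" by (simp flip: power_mult_distrib)
    let ?l = "(-1) ^ n * coeff P n * (\<Prod>i\<in>{1..n}-{j}. z i - \<i> * of_real (node n \<Omega> j))
        * exp (\<i> * of_real (\<Omega> * node n \<Omega> j / 2))"
    have "w \<longlonglongrightarrow> ?l"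
      unfolding w_def by (intro tendsto_intros limq f \<beta> v) auto
    moreover have "?l = of_real (\<mu> * c)"
      unfolding lead fun_cong [OF z_def, of j, symmetric] mult.assoc c(2) by simp
    ultimately have "(\<lambda>k. Re (w k)) \<longlonglongrightarrow> \<mu> * c"
      using tendsto_Re by fastforce
    then have "eventually (\<lambda>k. Re (w k) > 0) sequentially"
      using order_tendstoD(1) [of _ _ _ 0] mult_pos_pos [OF \<mu>(1) c(1)] by blast
    moreover have "eventually (\<lambda>k. \<beta> k > -1) sequentially" "eventually (\<lambda>k. \<beta> k < 1) sequentially"
      using order_tendstoD [OF \<beta>] nI by auto
    ultimately show ?thesis using qf
    proof eventually_elim
      case (elim k)
      have "f k j - \<i> * of_real (\<beta> k) = of_real (Re (f k j))"
        by (simp add: \<beta>_def complex_eq_iff)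
      moreover have "(\<Prod>i=1..n. \<i> * of_real (\<beta> k) - f k i) = (-1) ^ n * (\<Prod>i=1..n. f k i - \<i> * of_real (\<beta> k))"
      proof -
        have "(\<Prod>i=1..n. \<i> * of_real (\<beta> k) - f k i) = (\<Prod>i=1..n. (-1) * (f k i - \<i> * of_real (\<beta> k)))"
          by simp
        also have "\<dots> = (-1) ^ n * (\<Prod>i=1..n. f k i - \<i> * of_real (\<beta> k))"
          by (simp only: prod.distrib) simp
        finally show ?thesis .
      qed
      moreover have "(\<Prod>i=1..n. f k i - \<i> * of_real (\<beta> k))
          = (f k j - \<i> * of_real (\<beta> k)) * (\<Prod>i\<in>{1..n}-{j}. f k i - \<i> * of_real (\<beta> k))"
        using j by (intro prod.remove) auto
      moreover have "poly (q k) (\<i> * of_real (\<beta> k)) = coeff (q k) n * (\<Prod>i=1..n. \<i> * of_real (\<beta> k) - f k i)"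
        by (subst elim(4)) (simp add: poly_prod)
      ultimately have "twist (v k) (q k) (\<beta> k) = of_real (Re (f k j)) * w k"
        unfolding twist_def w_def by (simp only: mult_ac)
      then have "Re (f k j) * Re (w k) > 0"
        using posq [of "\<beta> k" k] elim(2,3) by simp
      then show ?case using elim(1) by (simp add: zero_less_mult_iff)
    qed
  qed
  have "eventually (\<lambda>k. \<forall>j\<in>{1..n}. Re (f k j) > 0) sequentially"
    using Re by (intro eventually_ball_finite) auto
  with qf have "eventually (\<lambda>k. proots (p (\<phi> k)) = image_mset (f k) (mset_set {1..n})
       \<and> (\<forall>j\<in>{1..n}. Re (f k j) > 0)) sequentially"
    by eventually_elim (use proots in blast)
  then show ?thesis using that \<phi> f unfolding z_def by blast
qed

text \<open>
  Otherwise there would be frequencies tending to \<open>\<Omega>\<close> and polynomials for which the assertion fails, against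
  the convergence along a subsequence.
\<close>
lemma eventually_roots_near_nodes:
  assumes n: "n \<ge> 1" and \<Omega>: "\<Omega> = (real n + 1) * pi" and \<epsilon>: "\<epsilon> > 0"
  shows "eventually (\<lambda>\<omega>. \<forall>p. degree p \<le> n \<longrightarrow> (\<forall>x\<in>{-1..1}. Re (twist \<omega> p x) > 0) \<longrightarrow>
    (\<exists>f. proots p = image_mset f (mset_set {1..n}) \<and>
      (\<forall>j\<in>{1..n}. cmod (f j - \<i> * of_real (node n \<Omega> j)) < \<epsilon> \<and> Re (f j) > 0))) (at_left \<Omega>)"
    (is "eventually (\<lambda>\<omega>. \<forall>p. ?pos \<omega> p \<longrightarrow> ?Pos \<omega> p \<longrightarrow> ?near p) _")
proof (rule sequentially_imp_eventually_at_left [of 0 \<Omega>])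
  show "0 < \<Omega>" using \<Omega> by simp
  fix X :: "nat \<Rightarrow> real" assume X: "X \<longlonglongrightarrow> \<Omega>"
  show "eventually (\<lambda>k. \<forall>p. ?pos (X k) p \<longrightarrow> ?Pos (X k) p \<longrightarrow> ?near p) sequentially"
  proof (rule ccontr)
    assume "\<not> ?thesis"
    from not_eventually_sequentiallyD [OF this]
    obtain s :: "nat \<Rightarrow> nat" where s: "strict_mono s"
      "\<forall>k. \<not> (\<forall>p. ?pos (X (s k)) p \<longrightarrow> ?Pos (X (s k)) p \<longrightarrow> ?near p)"
      by blast
    have "\<forall>k. \<exists>p. ?pos (X (s k)) p \<and> ?Pos (X (s k)) p \<and> \<not> ?near p"
      using s(2) by (simp only: not_all not_imp simp_thms)
    from choice [OF this] obtain p where p: "\<And>k. degree (p k) \<le> n" "\<And>k x. x \<in> {-1..1} \<Longrightarrow> Re (twist (X (s k)) (p k) x) > 0"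
      "\<And>k. \<not> ?near (p k)"
      by blast
    have "(\<lambda>k. X (s k)) \<longlonglongrightarrow> \<Omega>"
      using LIMSEQ_subseq_LIMSEQ [OF X s(1)] by (simp add: o_def)
    from positive_twist_roots_converge [OF n \<Omega> this p(1,2)]
    obtain \<phi> :: "nat \<Rightarrow> nat" and f where f: "\<And>j. j \<in> {1..n} \<Longrightarrow> (\<lambda>k. f k j) \<longlonglongrightarrow> \<i> * of_real (node n \<Omega> j)"
      and ev: "eventually (\<lambda>k. proots (p (\<phi> k)) = image_mset (f k) (mset_set {1..n})
         \<and> (\<forall>j\<in>{1..n}. Re (f k j) > 0)) sequentially"
      by blast
    have "eventually (\<lambda>k. \<forall>j\<in>{1..n}. cmod (f k j - \<i> * of_real (node n \<Omega> j)) < \<epsilon>) sequentially"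
      using tendstoD [OF f \<epsilon>] by (intro eventually_ball_finite) (auto simp: dist_norm)
    with ev have "eventually (\<lambda>k. ?near (p (\<phi> k))) sequentially"
      by eventually_elim blast
    then obtain k where "?near (p (\<phi> k))"
      using eventually_happens' [OF sequentially_bot] by blast
    then show False using p(3) by blast
  qed
qed


section \<open>Best approximations and their poles\<close>

text \<open>
  Optimality enters the asymptotic argument in this form. The real part has constant sign by the
  intermediate value theorem, and \<open>p\<close> and \<open>- p\<close> define the same rational function.
\<close>
lemma best_approx_positive_form:
  assumes \<omega>: "0 < \<omega>" "\<omega> < (real n + 1) * pi" and best: "best_approx n \<omega> u"
  shows "\<exists>p. degree p = n \<and> poles u = proots p \<and> (\<forall>x\<in>{-1..1}. Re (twist \<omega> p x) > 0)"
proof -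
  obtain p where p: "coprime p (dag p)" "degree p \<le> n" "u = Fraction_Field.Fract (dag p) p" "poles u = proots p"
    using best unitary_rat_coprime_form unfolding best_approx_def by metis
  have min: "exp_err \<omega> u \<le> exp_err \<omega> v" if "v \<in> unitary_rat n" for v
    using best that by (simp add: best_approx_def)
  have "exp_err \<omega> u < 2"
    using exists_unitary_err_less_2 [OF \<omega>] min by force
  then have nz: "Re (twist \<omega> p x) \<noteq> 0" if "x \<in> {-1..1}" for x
    using exp_err_less_2D p(1,3) that by blast
  have deg: "degree p = n"
  proof (rule ccontr)
    assume "degree p \<noteq> n"
    then have "degree p < n" using p(2) by simp
    then obtain v where "v \<in> unitary_rat n" "exp_err \<omega> v < exp_err \<omega> u"
      using non_maximal_degree_improvable [of \<omega> p n] \<omega> p(1,3) nz by auto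
    then show False using min by force
  qed
  have "(\<forall>x\<in>{-1..1}. Re (twist \<omega> p x) > 0) \<or> (\<forall>x\<in>{-1..1}. Re (twist \<omega> p x) < 0)"
  proof (rule ccontr)
    assume "\<not> ?thesis"
    then obtain x y where xy: "x \<in> {-1..1}" "y \<in> {-1..1}" "Re (twist \<omega> p x) \<le> 0" "Re (twist \<omega> p y) \<ge> 0"
      by (auto simp: not_less)
    have "connected ((\<lambda>x. Re (twist \<omega> p x)) ` {-1..1})"
      by (intro connected_continuous_image continuous_intros) simp
    then have "0 \<in> (\<lambda>x. Re (twist \<omega> p x)) ` {-1..1}"
      using xy unfolding connected_iff_interval by blast
    then show False using nz by force
  qed
  then show ?thesis
  proof
    assume "\<forall>x\<in>{-1..1}. Re (twist \<omega> p x) > 0"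
    then show ?thesis using deg p(4) by blast
  next
    assume "\<forall>x\<in>{-1..1}. Re (twist \<omega> p x) < 0"
    then show ?thesis using deg p(4) by (intro exI [of _ "- p"]) (simp add: twist_minus)
  qed
qed

lemma multiset_numbering: "\<exists>f. M = image_mset f (mset_set {1..size M})"
proof -
  obtain xs where xs: "mset xs = M" using ex_mset by blast
  let ?f = "\<lambda>j. xs ! (j - 1)"
  have "image_mset ?f (mset_set {1..size M}) = mset (map ?f [1..<Suc (length xs)])"
    by (simp flip: xs add: atLeastLessThanSuc_atLeastAtMost del: upt_Suc)
  also have "map ?f [1..<Suc (length xs)] = xs"
    by (intro nth_equalityI) (auto simp del: upt_Suc)
  finally show ?thesis using xs by metis
qed

text \<open>
  The poles have to be numbered separately for each \<open>\<omega>\<close>. Whenever some numbering puts every pole within \<open>\<delta>\<close>, half of the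
  distance between neighbouring limit points, of its limit point, one such numbering is chosen. Near the
  critical frequency the discs of radius \<open>\<delta>\<close> determine it uniquely, so any numbering that is even closer to the
  limit points coincides with it.
\<close>
theorem proposition9p4:
  fixes n :: nat and r :: "real \<Rightarrow> complex poly fract"
  assumes "n \<ge> 1"
    and "\<And>\<omega>. \<omega> \<in> {0<..<(real n + 1) * pi} \<Longrightarrow> best_approx n \<omega> (r \<omega>)"
  shows "\<exists>s :: nat \<Rightarrow> real \<Rightarrow> complex.
    (\<forall>\<omega>\<in>{0<..<(real n + 1) * pi}. poles (r \<omega>) = image_mset (\<lambda>j. s j \<omega>) (mset_set {1..n})) \<and>
    (\<forall>j\<in>{1..n}.
       (s j \<longlongrightarrow> \<i> * of_real (-1 + 2 * real j / (real n + 1))) (at_left ((real n + 1) * pi)) \<and>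
       filterlim (\<lambda>\<omega>. Re (s j \<omega>)) (at_right 0) (at_left ((real n + 1) * pi)))"
proof -
  define \<Omega> where "\<Omega> = (real n + 1) * pi"
  define z where "z = (\<lambda>j. \<i> * complex_of_real (-1 + 2 * real j / (real n + 1)))"
  have \<Omega>0: "\<Omega> > 0" by (simp add: \<Omega>_def)
  have node: "\<i> * of_real (node n \<Omega> j) = z j" for j
  proof -
    have "node n \<Omega> j = (2 * real j - (real n + 1)) / (real n + 1)"
      by (simp add: node_def \<Omega>_def)
    then show ?thesis by (simp add: z_def diff_divide_distrib)
  qed
  define \<delta> where "\<delta> = 1 / (real n + 1)"
  have \<delta>: "\<delta> > 0" by (simp add: \<delta>_def)
  have separated: "i = j" if "cmod (w - z i) < \<delta>" "cmod (w - z j) < \<delta>" for w i j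
  proof -
    have "cmod (z i - z j) < \<delta> + \<delta>"
      using norm_triangle_lt [of "z i - w" "w - z j" "\<delta> + \<delta>"] that by (simp add: norm_minus_commute)
    moreover have "z i - z j = \<i> * of_real (2 / (real n + 1) * (real i - real j))"
      by (simp add: z_def algebra_simps diff_divide_distrib)
    then have "cmod (z i - z j) = 2 / (real n + 1) * \<bar>real i - real j\<bar>"
      by (simp only: norm_mult norm_ii norm_of_real abs_mult) simp
    ultimately have "2 / (real n + 1) * \<bar>real i - real j\<bar> < 2 / (real n + 1) * 1"
      by (simp add: \<delta>_def)
    then have "\<bar>real i - real j\<bar> < 1"
      by (rule mult_less_cancel_left_pos [THEN iffD1, rotated]) simp
    then show ?thesis by linarith
  qed
  let ?num = "\<lambda>\<omega> f. poles (r \<omega>) = image_mset f (mset_set {1..n})"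
  let ?near = "\<lambda>\<epsilon> f. \<forall>j\<in>{1..n}. cmod (f j - z j) < \<epsilon>"
  have form: "\<exists>p. degree p = n \<and> poles (r \<omega>) = proots p \<and> (\<forall>x\<in>{-1..1}. Re (twist \<omega> p x) > 0)"
    if "0 < \<omega>" "\<omega> < \<Omega>" for \<omega>
    using best_approx_positive_form assms(2) that unfolding \<Omega>_def by simp
  have "\<exists>f. ?num \<omega> f \<and> ((\<exists>g. ?num \<omega> g \<and> ?near \<delta> g) \<longrightarrow> ?near \<delta> f)" if \<omega>: "0 < \<omega>" "\<omega> < \<Omega>" for \<omega>
  proof -
    have "size (poles (r \<omega>)) = n"
      using form [OF \<omega>] size_proots_complex by metis
    then have "\<exists>f. ?num \<omega> f" using multiset_numbering by metis
    then show ?thesis by blast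
  qed
  then obtain F where F: "\<And>\<omega>. 0 < \<omega> \<Longrightarrow> \<omega> < \<Omega> \<Longrightarrow> ?num \<omega> (F \<omega>)"
    "\<And>\<omega> g. 0 < \<omega> \<Longrightarrow> \<omega> < \<Omega> \<Longrightarrow> ?num \<omega> g \<Longrightarrow> ?near \<delta> g \<Longrightarrow> ?near \<delta> (F \<omega>)"
    by metis
  have close: "eventually (\<lambda>\<omega>. \<forall>j\<in>{1..n}. cmod (F \<omega> j - z j) < \<epsilon> \<and> Re (F \<omega> j) > 0) (at_left \<Omega>)"
    if "\<epsilon> > 0" for \<epsilon>
  proof -
    have "min \<epsilon> \<delta> > 0" using that \<delta> by simp
    from eventually_roots_near_nodes [OF assms(1) \<Omega>_def this]
    have "eventually (\<lambda>\<omega>. \<forall>p. degree p \<le> n \<longrightarrow> (\<forall>x\<in>{-1..1}. Re (twist \<omega> p x) > 0) \<longrightarrow>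
      (\<exists>g. proots p = image_mset g (mset_set {1..n}) \<and>
        (\<forall>j\<in>{1..n}. cmod (g j - z j) < min \<epsilon> \<delta> \<and> Re (g j) > 0))) (at_left \<Omega>)"
      unfolding node .
    moreover have "eventually (\<lambda>\<omega>. \<omega> \<in> {0<..<\<Omega>}) (at_left \<Omega>)"
      using eventually_at_left_real [OF \<Omega>0] .
    ultimately show ?thesis
    proof eventually_elim
      case (elim \<omega>)
      then have \<omega>: "0 < \<omega>" "\<omega> < \<Omega>" by auto
      from form [OF \<omega>] elim(1) obtain g where g: "?num \<omega> g"
        "\<And>j. j \<in> {1..n} \<Longrightarrow> cmod (g j - z j) < min \<epsilon> \<delta> \<and> Re (g j) > 0"
        by (metis order_refl)
      then have near: "?near \<delta> (F \<omega>)" using F(2) [OF \<omega>, of g] by simp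
      have "F \<omega> j = g j" if j: "j \<in> {1..n}" for j
      proof -
        have "g j \<in># poles (r \<omega>)" using j g(1) by simp
        then obtain i where i: "i \<in> {1..n}" "g j = F \<omega> i" using F(1) [OF \<omega>] by auto
        then have "i = j" using separated [of "g j" i j] near g(2) [OF j] by simp
        then show ?thesis using i by simp
      qed
      then show ?case using g(2) by simp
    qed
  qed
  have "((\<lambda>\<omega>. F \<omega> j) \<longlongrightarrow> z j) (at_left \<Omega>)" if "j \<in> {1..n}" for j
  proof (rule tendstoI)
    fix \<epsilon> :: real assume "\<epsilon> > 0"
    from close [OF this] show "eventually (\<lambda>\<omega>. dist (F \<omega> j) (z j) < \<epsilon>) (at_left \<Omega>)"
      by eventually_elim (use that in \<open>simp add: dist_norm\<close>)
  qed
  moreover have "filterlim (\<lambda>\<omega>. Re (F \<omega> j)) (at_right 0) (at_left \<Omega>)" if j: "j \<in> {1..n}" for j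
  proof -
    have "((\<lambda>\<omega>. Re (F \<omega> j)) \<longlongrightarrow> Re (z j)) (at_left \<Omega>)"
      using calculation [OF j] by (rule tendsto_Re)
    moreover have "eventually (\<lambda>\<omega>. Re (F \<omega> j) > 0) (at_left \<Omega>)"
      using close [OF zero_less_one] by eventually_elim (use j in simp)
    ultimately show ?thesis
      by (simp add: filterlim_at z_def eventually_mono less_imp_neq [symmetric])
  qed
  ultimately show ?thesis
    using F(1) unfolding \<Omega>_def z_def by (intro exI [of _ "\<lambda>j \<omega>. F \<omega> j"]) simp
qed

end
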